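(* Let $n\ge 3$ and $$\frac{2}{n}\sqrt{n-1}\le\kappa<1 .$$ Let $\Sigma$ be $\mathbb{R}^{n+1}$ endowed with a smooth conformally flat Riemannian metric $ds^2=e^{\phi(r)}\sum_{i=1}^{n+1}dx_i^2$, where $r=|x|=\sqrt{x_1^2+\cdots+x_{n+1}^2}$, the function $x\mapsto\phi(|x|)$ is smooth on $\mathbb{R}^{n+1}$, and $\phi'(r)\ge-2(1-\kappa)r^{-1}$ for all $r>0$. Then any hyperplane through the origin in $\Sigma$ (i.e. any $n$-dimensional linear subspace of $\mathbb{R}^{n+1}$, regarded as a hypersurface of $\Sigma$) is area-minimizing in $\Sigma$.
   Context: A hyperplane $T$ through the origin is area-minimizing in $\Sigma$ in the usual sense: a half-space $U$ bounded by $T$ is a perimeter-minimizing set (with respect to the metric of $\Sigma$) in every ball $B_R=\{|x|\le R\}$, $R>0$; that is, $U$ has no more perimeter than any competitor set of locally finite perimeter which differs from $U$ only in a compact subset of the interior of $B_R$. *)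

theory Defs
  imports "HOL-Analysis.Analysis"
begin

primrec C_k :: "nat \<Rightarrow> ('a::real_normed_vector \<Rightarrow> 'b::real_normed_vector) \<Rightarrow> bool" where
  "C_k 0 f \<longleftrightarrow> continuous_on UNIV f"
| "C_k (Suc k) f \<longleftrightarrow> (\<forall>x. f differentiable (at x)) \<and>
     (\<forall>v. C_k k (\<lambda>x. frechet_derivative f (at x) v))"

definition smooth :: "('a::real_normed_vector \<Rightarrow> 'b::real_normed_vector) \<Rightarrow> bool" where
  "smooth f \<longleftrightarrow> (\<forall>k. C_k k f)"

text \<open>
  A Riemannian metric on the manifold \<open>real ^ 'm\<close> is given in the standard global chart:
  \<open>g x u v\<close> is the inner product of the tangent vectors \<open>u\<close>, \<open>v\<close> at the point \<open>x\<close>.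
\<close>

type_synonym 'm metric = "real ^ 'm \<Rightarrow> real ^ 'm \<Rightarrow> real ^ 'm \<Rightarrow> real"

definition conformal_metric :: "(real \<Rightarrow> real) \<Rightarrow> ('m::finite) metric" where
  "conformal_metric \<phi> x u v = exp (\<phi> (norm x)) * (u \<bullet> v)"

definition vol_density :: "('m::finite) metric \<Rightarrow> real ^ 'm \<Rightarrow> real" where
  "vol_density g x = sqrt (det (\<chi> i j. g x (axis i 1) (axis j 1)))"

definition riem_vol :: "('m::finite) metric \<Rightarrow> (real ^ 'm) measure" where
  "riem_vol g = density lebesgue (\<lambda>x. ennreal (vol_density g x))"

text \<open>The coordinate formula \<open>div X = (1 / sqrt (det g)) \<Sum>\<^sub>i \<partial>\<^sub>i (sqrt (det g) X\<^sup>i)\<close>.\<close>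

definition riem_div :: "('m::finite) metric \<Rightarrow> (real ^ 'm \<Rightarrow> real ^ 'm) \<Rightarrow> real ^ 'm \<Rightarrow> real" where
  "riem_div g X x =
     (\<Sum>i\<in>UNIV. frechet_derivative (\<lambda>y. vol_density g y *\<^sub>R X y) (at x) (axis i 1) $ i)
       / vol_density g x"

definition test_fields :: "('m::finite) metric \<Rightarrow> (real ^ 'm) set \<Rightarrow> (real ^ 'm \<Rightarrow> real ^ 'm) set" where
  "test_fields g W = {X. C_k 1 X \<and> (\<exists>K. compact K \<and> K \<subseteq> W \<and> (\<forall>x. x \<notin> K \<longrightarrow> X x = 0)) \<and>
     (\<forall>x. sqrt (g x (X x) (X x)) \<le> 1)}"

text \<open>
  De Giorgi perimeter of a Lebesgue measurable set \<open>E\<close> in an open set \<open>W\<close>, with respect to \<open>g\<close>.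
\<close>

definition perimeter :: "('m::finite) metric \<Rightarrow> (real ^ 'm) set \<Rightarrow> (real ^ 'm) set \<Rightarrow> ereal" where
  "perimeter g E W = (SUP X\<in>test_fields g W. ereal (LINT x:E|riem_vol g. riem_div g X x))"

definition locally_finite_perimeter :: "('m::finite) metric \<Rightarrow> (real ^ 'm) set \<Rightarrow> bool" where
  "locally_finite_perimeter g E \<longleftrightarrow>
     E \<in> sets lebesgue \<and> (\<forall>W. open W \<and> bounded W \<longrightarrow> perimeter g E W < \<infinity>)"

text \<open>
  Every competitor \<open>E\<close> coincides with \<open>U\<close> near the sphere of radius \<open>R\<close>, so it makes no difference
  whether perimeters are compared in the closed ball or, as here, in its interior.
\<close>

definition perimeter_minimizing_in_ball :: "('m::finite) metric \<Rightarrow> (real ^ 'm) set \<Rightarrow> real \<Rightarrow> bool" where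
  "perimeter_minimizing_in_ball g U R \<longleftrightarrow>
     (\<forall>E. locally_finite_perimeter g E \<and>
          (\<exists>K. compact K \<and> K \<subseteq> interior (cball 0 R) \<and> sym_diff E U \<subseteq> K) \<longrightarrow>
        perimeter g U (interior (cball 0 R)) \<le> perimeter g E (interior (cball 0 R)))"

definition half_space_bounded_by :: "(real ^ 'm::finite) set \<Rightarrow> (real ^ 'm) set \<Rightarrow> bool" where
  "half_space_bounded_by T U \<longleftrightarrow>
     (\<exists>v. v \<noteq> 0 \<and> T = {x. v \<bullet> x = 0} \<and> U = {x. v \<bullet> x > 0})"

text \<open>
  Meant for hyperplanes \<open>T\<close> through the origin: these bound exactly two half-spaces, and both of
  them are required to minimize.
\<close>

definition area_minimizing :: "('m::finite) metric \<Rightarrow> (real ^ 'm) set \<Rightarrow> bool" where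
  "area_minimizing g T \<longleftrightarrow>
     (\<forall>U. half_space_bounded_by T U \<longrightarrow> (\<forall>R>0. perimeter_minimizing_in_ball g U R))"

end

theory Submission
  imports Defs
begin

text \<open>
  Write \<open>N = n + 1\<close> for the dimension and \<open>h = exp (n \<phi> / 2)\<close>. Rescaling test fields by the volume
  density identifies the Riemannian perimeter with the Euclidean perimeter of weight \<open>h\<close>
  (\<open>perimeter_conformal\<close>): the supremum of the integrals of \<open>div F\<close> over the set, where \<open>F\<close> has
  compact support and \<open>|F| \<le> h\<close>. So it suffices to calibrate the half-space \<open>{v \<bullet> x > 0}\<close>, \<open>|v| = 1\<close>, by a
  field \<open>Z\<close> with \<open>|Z| \<le> h\<close>, with \<open>Z = h v\<close> on the hyperplane, and with \<open>div Z\<close> of the same sign as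
  \<open>v \<bullet> x\<close>.

  Up to the factor \<open>h\<close>, let \<open>Z\<close> depend only on \<open>x / |x|\<close> and be rotationally symmetric about \<open>v\<close>. At
  latitude \<open>\<theta>\<close> above the hyperplane let \<open>Z\<close> lean from the meridian towards the radial direction by an
  angle \<open>\<psi>(\<theta>)\<close>, with \<open>\<psi>(0) = 0\<close>. The bound on \<open>\<phi>'\<close> says that \<open>n + r h' / h \<ge> n \<kappa>\<close>, and \<open>div Z \<ge> 0\<close>
  for \<open>\<theta> > 0\<close> follows from \<open>\<psi>' + (n - 1) tan \<theta> cot \<psi> \<le> n \<kappa>\<close>. The choice \<open>tan \<psi> = c tan \<theta>\<close> with
  \<open>c \<ge> 1\<close> gives \<open>\<psi>' \<le> c\<close> and makes the second term equal to \<open>(n - 1) / c\<close>. For \<open>c = sqrt (n - 1)\<close> both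
  are at most \<open>c\<close>, and \<open>2 c \<le> n \<kappa>\<close> is the hypothesis on \<open>\<kappa>\<close>. In Cartesian form, \<open>Z\<close> is \<open>h\<close> times the
  normalization of \<open>|x|\<^sup>2 v + (c - 1) (v \<bullet> x) x\<close>, and so is smooth away from the origin.

  Replacing \<open>|x|\<^sup>2\<close> by \<open>|x|\<^sup>2 + \<epsilon>\<close> makes \<open>Z\<close> continuously differentiable everywhere. It keeps \<open>|Z| \<le> h\<close>
  (\<open>norm_calib_le\<close>) and the values on the hyperplane (\<open>calib_on_hyperplane\<close>), and it spoils the sign of
  the divergence only by a term of size \<open>\<epsilon> / (|x|\<^sup>2 + \<epsilon>)\<close> times a continuous function
  (\<open>divergence_calib_bounds\<close>); its integral over a ball tends to 0 with \<open>\<epsilon>\<close>. The calibration argument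
  is \<open>half_space_perimeter_le\<close>. The divergence theorem enters only through
  \<open>integral_divergence_half_space_nonpos\<close>, which needs no surface measure.
\<close>

section \<open>Continuously differentiable maps\<close>

lemma C1_iff:
  "C_k 1 f \<longleftrightarrow> (\<forall>x. f differentiable (at x)) \<and>
     (\<forall>v. continuous_on UNIV (\<lambda>x. frechet_derivative f (at x) v))"
  by (simp only: One_nat_def C_k.simps)

lemma frechet_derivative_eqI:
  "(f has_derivative f') (at x) \<Longrightarrow> frechet_derivative f (at x) = f'"
  by (rule frechet_derivative_at[symmetric])

lemma C1I:
  assumes "\<And>x. (f has_derivative f' x) (at x)" "\<And>v. continuous_on UNIV (\<lambda>x. f' x v)"
  shows "C_k 1 f"
proof -
  have "frechet_derivative f (at x) = f' x" for x
    using assms(1) by (rule frechet_derivative_eqI)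
  then show ?thesis
    unfolding C1_iff using assms by (auto intro: differentiableI)
qed

lemma C1_has_derivative:
  "C_k 1 f \<Longrightarrow> (f has_derivative frechet_derivative f (at x)) (at x)"
  unfolding C1_iff using frechet_derivative_works by blast

lemma C1_continuous_derivative:
  "C_k 1 f \<Longrightarrow> continuous_on UNIV (\<lambda>x. frechet_derivative f (at x) v)"
  unfolding C1_iff by blast

lemma C1_continuous: "C_k 1 f \<Longrightarrow> continuous_on UNIV f"
  by (intro continuous_at_imp_continuous_on ballI has_derivative_continuous[OF C1_has_derivative])

lemma C1_const: "C_k 1 (\<lambda>x. c)"
  by (rule C1I[OF has_derivative_const]) simp

lemma C1_bounded_linear: "bounded_linear f \<Longrightarrow> C_k 1 f"
  by (rule C1I[OF bounded_linear_imp_has_derivative]) auto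

lemma C1_add: "C_k 1 f \<Longrightarrow> C_k 1 g \<Longrightarrow> C_k 1 (\<lambda>x. f x + g x)"
  by (rule C1I[OF has_derivative_add[OF C1_has_derivative C1_has_derivative]])
     (auto intro!: continuous_on_add continuous_on_diff continuous_on_minus C1_continuous_derivative simp del: One_nat_def)

lemma C1_minus: "C_k 1 f \<Longrightarrow> C_k 1 (\<lambda>x. - f x)"
  by (rule C1I[OF has_derivative_minus[OF C1_has_derivative]])
     (auto intro!: continuous_on_add continuous_on_diff continuous_on_minus C1_continuous_derivative simp del: One_nat_def)

lemma C1_diff: "C_k 1 f \<Longrightarrow> C_k 1 g \<Longrightarrow> C_k 1 (\<lambda>x. f x - g x)"
  by (rule C1I[OF has_derivative_diff[OF C1_has_derivative C1_has_derivative]])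
     (auto intro!: continuous_on_add continuous_on_diff continuous_on_minus C1_continuous_derivative simp del: One_nat_def)

lemma C1_scaleR:
  fixes f :: "'a::real_normed_vector \<Rightarrow> real"
  shows "C_k 1 f \<Longrightarrow> C_k 1 g \<Longrightarrow> C_k 1 (\<lambda>x. f x *\<^sub>R g x)"
  by (rule C1I[OF has_derivative_scaleR[OF C1_has_derivative C1_has_derivative]])
     (auto intro!: continuous_on_add continuous_on_scaleR continuous_on_inner C1_continuous_derivative intro: C1_continuous simp del: One_nat_def)

lemma C1_mult:
  fixes f g :: "'a::real_normed_vector \<Rightarrow> real"
  shows "C_k 1 f \<Longrightarrow> C_k 1 g \<Longrightarrow> C_k 1 (\<lambda>x. f x * g x)"
  using C1_scaleR[of f g] by simp

lemma C1_inner: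
  fixes f g :: "'a::real_normed_vector \<Rightarrow> 'b::real_inner"
  shows "C_k 1 f \<Longrightarrow> C_k 1 g \<Longrightarrow> C_k 1 (\<lambda>x. f x \<bullet> g x)"
  by (rule C1I[OF has_derivative_inner[OF C1_has_derivative C1_has_derivative]])
     (auto intro!: continuous_on_add continuous_on_scaleR continuous_on_inner C1_continuous_derivative intro: C1_continuous simp del: One_nat_def)

lemma has_derivative_real_compose:
  fixes f :: "'a::real_normed_vector \<Rightarrow> real"
  assumes "(f has_derivative f') (at x)" "(g has_real_derivative g') (at (f x))"
  shows "((\<lambda>x. g (f x)) has_derivative (\<lambda>u. g' * f' u)) (at x)"
  using has_derivative_compose[OF assms(1), of g "(*) g'"] assms(2)
  by (simp add: has_field_derivative_def)

lemma C1_real_compose: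
  fixes f :: "'a::real_normed_vector \<Rightarrow> real"
  assumes f: "C_k 1 f" and "\<And>x. f x \<in> S"
    and "\<And>y. y \<in> S \<Longrightarrow> (g has_real_derivative g' y) (at y)" and g': "continuous_on S g'"
  shows "C_k 1 (\<lambda>x. g (f x))"
proof (rule C1I)
  show "((\<lambda>x. g (f x)) has_derivative (\<lambda>u. g' (f x) * frechet_derivative f (at x) u)) (at x)" for x
    using assms by (intro has_derivative_real_compose C1_has_derivative) auto
  have "continuous_on UNIV (\<lambda>x. g' (f x))"
    using continuous_on_compose2[OF g' C1_continuous[OF f]] assms(2) by auto
  then show "continuous_on UNIV (\<lambda>x. g' (f x) * frechet_derivative f (at x) v)" for v
    by (intro continuous_intros C1_continuous_derivative f)
qed

lemma C1_divide:
  fixes f g :: "'a::real_normed_vector \<Rightarrow> real"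
  assumes "C_k 1 f" "C_k 1 g" "\<And>x. g x > 0"
  shows "C_k 1 (\<lambda>x. f x / g x)"
proof -
  have "C_k 1 (\<lambda>x. inverse (g x))"
    by (rule C1_real_compose[where S="{0<..}" and g'="\<lambda>y. - inverse (y^2)"])
       (use assms in \<open>auto intro!: derivative_eq_intros continuous_intros simp: power2_eq_square\<close>)
  then show ?thesis
    using C1_mult[OF assms(1)] by (simp add: divide_inverse)
qed

lemma C1_exp:
  fixes f :: "'a::real_normed_vector \<Rightarrow> real"
  shows "C_k 1 f \<Longrightarrow> C_k 1 (\<lambda>x. exp (f x))"
  by (rule C1_real_compose[where S=UNIV and g'=exp])
     (auto intro!: derivative_eq_intros continuous_intros)

lemma C1_ln:
  fixes f :: "'a::real_normed_vector \<Rightarrow> real"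
  shows "C_k 1 f \<Longrightarrow> (\<And>x. f x > 0) \<Longrightarrow> C_k 1 (\<lambda>x. ln (f x))"
  by (rule C1_real_compose[where S="{0<..}" and g'=inverse])
     (auto intro!: derivative_eq_intros continuous_intros simp: divide_inverse)

text \<open>
  The square of the positive part is the cheapest \<open>C\<^sup>1\<close> function that vanishes exactly on a
  half-line; all cutoffs below are rational expressions in it.
\<close>

definition possq :: "real \<Rightarrow> real" where "possq t = (max 0 t)\<^sup>2"

lemma possq_nonneg: "0 \<le> possq t" by (simp add: possq_def)
lemma possq_pos_iff: "0 < possq t \<longleftrightarrow> 0 < t" by (auto simp: possq_def max_def)
lemma possq_eq_0_iff: "possq t = 0 \<longleftrightarrow> t \<le> 0" by (simp add: possq_def max_def)

lemma DERIV_possq: "(possq has_real_derivative 2 * max 0 t) (at t)"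
proof -
  consider "t < 0" | "t = 0" | "t > 0" by linarith
  then show ?thesis
  proof cases
    case 1
    have "((\<lambda>t. 0) has_real_derivative 2 * max 0 t) (at t)" using 1 by simp
    then show ?thesis
      by (rule has_field_derivative_transform_within[where d="-t"]) (use 1 in \<open>auto simp: possq_def dist_real_def\<close>)
  next
    case 3
    have "((\<lambda>t. t\<^sup>2) has_real_derivative 2 * max 0 t) (at t)"
      using 3 by (auto intro!: derivative_eq_intros)
    then show ?thesis
      by (rule has_field_derivative_transform_within[where d="t"]) (use 3 in \<open>auto simp: possq_def dist_real_def\<close>)
  next
    case 2
    have "(\<lambda>h. (possq h) / h) \<midarrow>0\<rightarrow> 0"
    proof (rule Lim_null_comparison)
      show "\<forall>\<^sub>F h in at 0. norm (possq h / h) \<le> \<bar>h\<bar>"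
        by (rule always_eventually) (auto simp: possq_def max_def power2_eq_square)
      show "(\<lambda>h::real. \<bar>h\<bar>) \<midarrow>0\<rightarrow> 0"
        by (rule tendsto_eq_intros)+ auto
    qed
    then show ?thesis using 2 by (simp add: DERIV_def possq_def)
  qed
qed

lemma C1_possq:
  fixes f :: "'a::real_normed_vector \<Rightarrow> real"
  shows "C_k 1 f \<Longrightarrow> C_k 1 (\<lambda>x. possq (f x))"
  by (rule C1_real_compose[where S=UNIV and g'="\<lambda>y. 2 * max 0 y"])
     (auto intro!: DERIV_possq continuous_intros)

section \<open>Cutoff functions\<close>

text \<open>
  With \<open>a\<close> positive exactly inside the larger ball and \<open>b\<close> positive exactly outside the smaller
  one, \<open>a / (a + b)\<close> is a cutoff: since \<open>\<rho> < \<sigma>\<close>, the two never vanish simultaneously.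
\<close>

lemma C1_cutoff:
  fixes \<rho> \<sigma> :: real
  assumes "0 < \<rho>" "\<rho> < \<sigma>"
  obtains \<eta> :: "'a::euclidean_space \<Rightarrow> real"
  where "C_k 1 \<eta>" "\<And>x. 0 \<le> \<eta> x" "\<And>x. \<eta> x \<le> 1"
    "\<And>x. norm x \<le> \<rho> \<Longrightarrow> \<eta> x = 1" "\<And>x. norm x > \<sigma> \<Longrightarrow> \<eta> x = 0"
proof -
  define a where "a x = possq (\<sigma>\<^sup>2 - x \<bullet> x)" for x :: 'a
  define b where "b x = possq (x \<bullet> x - \<rho>\<^sup>2)" for x :: 'a
  have id: "C_k 1 (\<lambda>x::'a. x)" by (intro C1_bounded_linear bounded_linear_ident)
  have C1: "C_k 1 a" "C_k 1 b"
    unfolding a_def b_def by (intro C1_possq C1_diff C1_const C1_inner id)+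
  have nn: "0 \<le> a x" "0 \<le> b x" for x by (simp_all add: a_def b_def possq_nonneg)
  have "\<rho>\<^sup>2 < \<sigma>\<^sup>2" using assms by (simp add: power_strict_mono)
  then have "0 < a x \<or> 0 < b x" for x unfolding a_def b_def possq_pos_iff by linarith
  then have pos: "0 < a x + b x" for x using nn[of x] by (smt (verit))
  show thesis
  proof
    show "C_k 1 (\<lambda>x. a x / (a x + b x))" using pos by (intro C1_divide C1_add C1)
    fix x
    show "0 \<le> a x / (a x + b x)" "a x / (a x + b x) \<le> 1"
      using nn[of x] pos[of x] by (simp_all add: divide_le_eq)
    show "a x / (a x + b x) = 1" if "norm x \<le> \<rho>"
    proof -
      have "x \<bullet> x \<le> \<rho>\<^sup>2" using that by (simp add: dot_square_norm power_mono)
      then have "b x = 0" by (simp add: b_def possq_eq_0_iff)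
      then show ?thesis using pos[of x] by simp
    qed
    show "a x / (a x + b x) = 0" if "norm x > \<sigma>"
    proof -
      have "\<sigma>\<^sup>2 \<le> x \<bullet> x" using that assms by (simp add: dot_square_norm power_mono)
      then show ?thesis by (simp add: a_def possq_eq_0_iff)
    qed
  qed
qed

lemma compact_subset_smaller_ball:
  fixes K :: "'a::real_normed_vector set"
  assumes "compact K" "K \<subseteq> ball 0 R" "0 < R"
  obtains \<rho> where "0 < \<rho>" "\<rho> < R" "K \<subseteq> ball 0 \<rho>"
proof (cases "K = {}")
  case True
  then show thesis using that[of "R/2"] assms by auto
next
  case False
  obtain y where y: "y \<in> K" "\<And>x. x \<in> K \<Longrightarrow> norm x \<le> norm y"
    using continuous_attains_sup[OF assms(1) False continuous_on_norm_id] by auto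
  then have "norm y < R" using assms by auto
  then show thesis
    using that[of "(norm y + R) / 2"] y assms(3) norm_ge_zero[of y] by (force simp: subset_iff)
qed

section \<open>Divergence\<close>

text \<open>
  The Euclidean divergence, in the form in which it occurs inside \<open>riem_div\<close>.
\<close>

definition divergence :: "(real ^ 'm \<Rightarrow> real ^ 'm) \<Rightarrow> real ^ 'm::finite \<Rightarrow> real" where
  "divergence F x = (\<Sum>i\<in>UNIV. frechet_derivative F (at x) (axis i 1) $ i)"

lemma divergence_eqI:
  "(F has_derivative F') (at x) \<Longrightarrow> divergence F x = (\<Sum>i\<in>UNIV. F' (axis i 1) $ i)"
  by (simp add: divergence_def frechet_derivative_eqI)

lemma linear_sum_axis:
  fixes L :: "real ^ 'm::finite \<Rightarrow> real"
  assumes "bounded_linear L"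
  shows "(\<Sum>i\<in>UNIV. L (axis i 1) * v $ i) = L v"
proof -
  interpret bounded_linear L by fact
  have "L v = L (\<Sum>i\<in>UNIV. v $ i *s axis i 1)" by (simp add: basis_expansion)
  also have "\<dots> = (\<Sum>i\<in>UNIV. L (axis i 1) * v $ i)"
    by (simp add: sum scalar_mult_eq_scaleR scaleR mult.commute)
  finally show ?thesis by simp
qed

lemma abs_linear_le_sum_axis:
  fixes L :: "real ^ 'm::finite \<Rightarrow> real"
  assumes "bounded_linear L"
  shows "\<bar>L u\<bar> \<le> norm u * (\<Sum>i\<in>UNIV. \<bar>L (axis i 1)\<bar>)"
proof -
  have "\<bar>L u\<bar> \<le> (\<Sum>i\<in>UNIV. \<bar>L (axis i 1) * u $ i\<bar>)"
    unfolding linear_sum_axis[OF assms, of u, symmetric] by (rule sum_abs)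
  also have "\<dots> \<le> (\<Sum>i\<in>UNIV. \<bar>L (axis i 1)\<bar> * norm u)"
    using component_le_norm_cart[of u] by (intro sum_mono) (simp add: abs_mult mult_left_mono)
  finally show ?thesis by (simp add: sum_distrib_left mult.commute)
qed

lemma divergence_scaleR:
  fixes f :: "real ^ 'm::finite \<Rightarrow> real"
  assumes "(f has_derivative f') (at x)" "C_k 1 F"
  shows "divergence (\<lambda>x. f x *\<^sub>R F x) x = f' (F x) + f x * divergence F x"
proof -
  note h = has_derivative_scaleR[OF assms(1) C1_has_derivative[OF assms(2)]]
  have "divergence (\<lambda>x. f x *\<^sub>R F x) x =
     (\<Sum>i\<in>UNIV. f' (axis i 1) * F x $ i) + f x * divergence F x"
    by (subst divergence_eqI[OF h]) (simp add: sum.distrib sum_distrib_left divergence_def add.commute)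
  also have "(\<Sum>i\<in>UNIV. f' (axis i 1) * F x $ i) = f' (F x)"
    using assms(1) by (intro linear_sum_axis) (rule has_derivative_bounded_linear)
  finally show ?thesis .
qed

lemma divergence_diff:
  assumes "C_k 1 F" "C_k 1 G"
  shows "divergence (\<lambda>x. F x - G x) x = divergence F x - divergence G x"
  by (subst divergence_eqI[OF has_derivative_diff[OF assms[THEN C1_has_derivative]]])
     (simp add: divergence_def sum_subtractf)

lemma divergence_minus:
  assumes "C_k 1 F"
  shows "divergence (\<lambda>x. - F x) x = - divergence F x"
  by (subst divergence_eqI[OF has_derivative_minus[OF assms[THEN C1_has_derivative]]])
     (simp add: divergence_def sum_negf)

lemma divergence_cong_open:
  assumes "open S" "x \<in> S" "\<And>y. y \<in> S \<Longrightarrow> F y = G y" "C_k 1 F"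
  shows "divergence F x = divergence G x"
proof -
  have "(G has_derivative frechet_derivative F (at x)) (at x)"
    using has_derivative_transform_within_open[OF C1_has_derivative[OF assms(4)] assms(1,2,3)] .
  from divergence_eqI[OF this] show ?thesis by (simp add: divergence_def)
qed

lemma continuous_divergence: "C_k 1 F \<Longrightarrow> continuous_on UNIV (divergence F)"
  unfolding divergence_def by (intro continuous_intros C1_continuous_derivative)

lemma derivative_zero_outside:
  assumes "\<And>x. norm x > r \<Longrightarrow> F x = 0" "norm x > r"
  shows "(F has_derivative (\<lambda>_. 0)) (at x)"
proof (rule has_derivative_transform_within_open[where s="{x. norm x > r}"])
  show "((\<lambda>x. 0) has_derivative (\<lambda>_. 0)) (at x)" by simp
  show "open {x::'a. norm x > r}" by (intro open_Collect_less continuous_intros)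
qed (use assms in auto)

lemma divergence_zero_outside:
  assumes "\<And>x. norm x > r \<Longrightarrow> F x = 0" "norm x > r"
  shows "divergence F x = 0"
  by (subst divergence_eqI[OF derivative_zero_outside[of r]]) (use assms in auto)

section \<open>The divergence theorem for compactly supported fields\<close>

lemma borel_measurable_lebesgue_continuous:
  fixes f :: "'a::euclidean_space \<Rightarrow> real"
  shows "continuous_on UNIV f \<Longrightarrow> f \<in> borel_measurable lebesgue"
  by (simp add: measurable_completion borel_measurable_continuous_onI)

lemma integrable_indicator_cball:
  fixes x :: "'a::euclidean_space"
  shows "integrable lebesgue (indicat_real (cball x r))"
  using emeasure_lborel_cball_finite[of x r] by (intro integrable_real_indicator) auto

lemma bounded_continuous_compact_support:
  fixes f :: "'a::euclidean_space \<Rightarrow> real"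
  assumes f: "continuous_on UNIV f" and z: "\<And>x. norm x > r \<Longrightarrow> f x = 0"
  obtains M where "M \<ge> 0" "\<And>x. \<bar>f x\<bar> \<le> M"
proof -
  have "bounded (f ` cball 0 r)"
    using f by (intro compact_imp_bounded compact_continuous_image) (auto intro: continuous_on_subset)
  then obtain M where M: "\<And>x. x \<in> cball 0 r \<Longrightarrow> \<bar>f x\<bar> \<le> M"
    unfolding bounded_iff real_norm_def by (metis imageI)
  have "\<bar>f x\<bar> \<le> \<bar>M\<bar>" for x
    using M[of x] z[of x] by (cases "norm x > r") auto
  then show thesis using that[of "\<bar>M\<bar>"] by simp
qed

lemma integrable_continuous_compact_support:
  fixes f :: "'a::euclidean_space \<Rightarrow> real"
  assumes f: "continuous_on UNIV f" and E: "E \<in> sets lebesgue"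
    and z: "\<And>x. norm x > r \<Longrightarrow> f x = 0"
  shows "integrable lebesgue (\<lambda>x. indicator E x * f x)"
proof -
  obtain M where M: "\<And>x. \<bar>f x\<bar> \<le> M"
    using bounded_continuous_compact_support[OF f z] by blast
  have fm: "f \<in> borel_measurable lebesgue"
    using f by (rule borel_measurable_lebesgue_continuous)
  show ?thesis
  proof (rule Bochner_Integration.integrable_bound[where f="\<lambda>x. indicat_real (cball 0 r) x * M"])
    show "integrable lebesgue (\<lambda>x. indicat_real (cball 0 r) x * M)"
      by (intro integrable_mult_left integrable_indicator_cball)
    show "(\<lambda>x. indicator E x * f x) \<in> borel_measurable lebesgue"
      using E fm by measurable
    show "AE x in lebesgue. norm (indicator E x * f x) \<le> norm (indicat_real (cball 0 r) x * M)"
    proof (rule AE_I2)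
      fix x
      show "norm (indicator E x * f x) \<le> norm (indicat_real (cball 0 r) x * M)"
        using M[of x] z[of x] by (cases "norm x > r") (auto simp: indicator_def)
    qed
  qed
qed

lemma lebesgue_integral_translate:
  fixes f :: "'a::euclidean_space \<Rightarrow> real"
  assumes "f \<in> borel_measurable borel"
  shows "(LINT x|lebesgue. f (a + x)) = (LINT x|lebesgue. f x)"
proof -
  have "(LINT x|lebesgue. f (a + x)) = (LINT x|lborel. f (a + x))"
    using measurable_compose[OF _ assms, of "(+) a" borel] by (intro integral_completion) simp
  also have "\<dots> = (LINT x|distr lborel borel ((+) a). f x)"
    using assms by (subst integral_distr) auto
  also have "\<dots> = (LINT x|lborel. f x)"
    by (simp add: lborel_distr_plus)
  also have "\<dots> = (LINT x|lebesgue. f x)"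
    using assms by (intro integral_completion[symmetric]) measurable
  finally show ?thesis .
qed

text \<open>
  Translation invariance replaces integration by parts: each difference quotient of \<open>f\<close> in the
  direction \<open>e\<close> has integral zero, and by the mean value theorem the quotients are uniformly
  bounded with common compact support, so the integral of their limit vanishes too.
\<close>

lemma integral_directional_derivative_zero:
  fixes f :: "'a::euclidean_space \<Rightarrow> real"
  assumes f: "C_k 1 f" and z: "\<And>x. norm x > r \<Longrightarrow> f x = 0"
  shows "(LINT x|lebesgue. frechet_derivative f (at x) e) = 0"
proof -
  define d where "d x = frechet_derivative f (at x) e" for x
  define t :: "nat \<Rightarrow> real" where "t k = 1 / real (Suc k)" for k
  have t: "0 < t k" "t k \<le> 1" for k by (auto simp: t_def)
  have t0: "t \<longlonglongrightarrow> 0" unfolding t_def by (rule LIMSEQ_Suc[OF lim_1_over_n])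
  define q where "q k x = (f (t k *\<^sub>R e + x) - f x) / t k" for k x
  have d_cont: "continuous_on UNIV d"
    unfolding d_def using f by (rule C1_continuous_derivative)
  have f_cont: "continuous_on UNIV f" using f by (rule C1_continuous)
  have f_bm: "f \<in> borel_measurable borel" "d \<in> borel_measurable borel"
    using f_cont d_cont by (auto intro: borel_measurable_continuous_onI)
  have dz: "d x = 0" if "norm x > r" for x
    unfolding d_def by (simp add: frechet_derivative_eqI[OF derivative_zero_outside[OF z that]])
  obtain M where dM: "\<And>x. \<bar>d x\<bar> \<le> \<bar>M\<bar>"
    using bounded_continuous_compact_support[OF d_cont dz] by (metis abs_of_nonneg)
  have line: "((\<lambda>s. f (s *\<^sub>R e + x)) has_real_derivative d (s *\<^sub>R e + x)) (at s)" for s x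
  proof -
    have "((\<lambda>s. s *\<^sub>R e + x) has_derivative (\<lambda>h. h *\<^sub>R e)) (at s)"
      by (auto intro!: derivative_eq_intros)
    from has_derivative_compose[OF this C1_has_derivative[OF f]]
    have "((\<lambda>s. f (s *\<^sub>R e + x)) has_derivative
        (\<lambda>h. frechet_derivative f (at (s *\<^sub>R e + x)) (h *\<^sub>R e))) (at s)" .
    moreover have "frechet_derivative f (at (s *\<^sub>R e + x)) (h *\<^sub>R e) = d (s *\<^sub>R e + x) * h" for h
      using linear_scale[OF has_derivative_linear[OF C1_has_derivative[OF f]]] by (simp add: d_def)
    ultimately show ?thesis by (simp add: has_field_derivative_def)
  qed
  have q_bound: "\<bar>q k x\<bar> \<le> indicat_real (cball 0 (\<bar>r\<bar> + norm e)) x * \<bar>M\<bar>" for k x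
  proof (cases "norm x > \<bar>r\<bar> + norm e")
    case True
    have "norm (t k *\<^sub>R e) \<le> norm e"
      using t[of k] by (simp add: mult_left_le_one_le)
    then have "norm (t k *\<^sub>R e + x) > r"
      using norm_triangle_ineq4[of "t k *\<^sub>R e + x" "t k *\<^sub>R e"] True by simp
    moreover have "norm x > r" using True norm_ge_zero[of e] by linarith
    ultimately show ?thesis using z by (simp add: q_def)
  next
    case False
    obtain \<xi> where "f (t k *\<^sub>R e + x) - f (0 *\<^sub>R e + x) = (t k - 0) * d (\<xi> *\<^sub>R e + x)"
      using MVT2[of 0 "t k" "\<lambda>s. f (s *\<^sub>R e + x)" "\<lambda>s. d (s *\<^sub>R e + x)"] t[of k] line by blast
    then have "q k x = d (\<xi> *\<^sub>R e + x)" using t[of k] by (simp add: q_def)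
    then show ?thesis using dM False by simp
  qed
  have "(\<lambda>k. LINT x|lebesgue. q k x) \<longlonglongrightarrow> (LINT x|lebesgue. d x)"
  proof (rule integral_dominated_convergence[where w="\<lambda>x. indicat_real (cball 0 (\<bar>r\<bar> + norm e)) x * \<bar>M\<bar>"])
    show "d \<in> borel_measurable lebesgue" using f_bm by (simp add: measurable_completion)
    show "q k \<in> borel_measurable lebesgue" for k
    proof -
      have "(\<lambda>x. f (t k *\<^sub>R e + x)) \<in> borel_measurable borel"
        by (intro borel_measurable_continuous_onI continuous_on_compose2[OF f_cont] continuous_intros) auto
      then show ?thesis
        unfolding q_def using f_bm(1) by (intro measurable_completion) (simp add: borel_measurable_divide)
    qed
    show "integrable lebesgue (\<lambda>x. indicat_real (cball 0 (\<bar>r\<bar> + norm e)) x * \<bar>M\<bar>)"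
      by (intro integrable_mult_left integrable_indicator_cball)
    show "AE x in lebesgue. (\<lambda>k. q k x) \<longlonglongrightarrow> d x"
    proof (rule AE_I2)
      fix x
      have "((\<lambda>h. (f (h *\<^sub>R e + x) - f x) / h) \<longlongrightarrow> d x) (at 0)"
        using line[of x 0] by (simp add: DERIV_def)
      moreover have "filterlim t (at 0) sequentially"
        using t0 t by (auto simp: filterlim_at less_imp_neq[THEN not_sym])
      ultimately show "(\<lambda>k. q k x) \<longlonglongrightarrow> d x"
        unfolding q_def by (rule filterlim_compose)
    qed
    show "AE x in lebesgue. norm (q k x) \<le> indicat_real (cball 0 (\<bar>r\<bar> + norm e)) x * \<bar>M\<bar>" for k
      using q_bound by auto
  qed
  moreover have "(LINT x|lebesgue. q k x) = 0" for k
  proof -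
    have i: "integrable lebesgue f"
      using integrable_continuous_compact_support[OF f_cont _ z, of UNIV r] by simp
    have i2: "integrable lebesgue (\<lambda>x. f (t k *\<^sub>R e + x))"
    proof -
      have "f (t k *\<^sub>R e + x) = 0" if "norm x > r + norm (t k *\<^sub>R e)" for x
        using z[of "t k *\<^sub>R e + x"] that norm_triangle_ineq4[of "t k *\<^sub>R e + x" "t k *\<^sub>R e"] by simp
      moreover have "continuous_on UNIV (\<lambda>x. f (t k *\<^sub>R e + x))"
        by (intro continuous_on_compose2[OF f_cont] continuous_intros) auto
      ultimately show ?thesis
        using integrable_continuous_compact_support[of "\<lambda>x. f (t k *\<^sub>R e + x)" UNIV "r + norm (t k *\<^sub>R e)"]
        by simp
    qed
    show ?thesis
      unfolding q_def using i i2 lebesgue_integral_translate[OF f_bm(1), of "t k *\<^sub>R e"] by simp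
  qed
  ultimately have "(LINT x|lebesgue. d x) = 0"
    using LIMSEQ_unique[OF _ tendsto_const] by simp
  then show ?thesis by (simp add: d_def)
qed

lemma integral_divergence_zero:
  fixes F :: "real ^ 'm::finite \<Rightarrow> real ^ 'm"
  assumes F: "C_k 1 F" and z: "\<And>x. norm x > r \<Longrightarrow> F x = 0"
  shows "(LINT x|lebesgue. divergence F x) = 0"
proof -
  have comp: "C_k 1 (\<lambda>x. F x $ i)" for i
    using C1_inner[OF F C1_const[of "axis i 1"]] by (simp add: inner_axis)
  have D: "frechet_derivative F (at x) u $ i = frechet_derivative (\<lambda>x. F x $ i) (at x) u" for x u i
  proof -
    have "((\<lambda>x. F x $ i) has_derivative (\<lambda>u. frechet_derivative F (at x) u $ i)) (at x)"
      by (rule bounded_linear.has_derivative[OF bounded_linear_vec_nth C1_has_derivative[OF F]])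
    from frechet_derivative_eqI[OF this] show ?thesis by simp
  qed
  have "integrable lebesgue (\<lambda>x. frechet_derivative (\<lambda>x. F x $ i) (at x) u)" for i u
  proof -
    have "frechet_derivative (\<lambda>x. F x $ i) (at x) u = 0" if "norm x > r" for x
      by (subst frechet_derivative_eqI[OF derivative_zero_outside[of r]]) (use z that in auto)
    then show ?thesis
      using integrable_continuous_compact_support[OF C1_continuous_derivative[OF comp], of UNIV r] by simp
  qed
  then have "(LINT x|lebesgue. divergence F x) =
     (\<Sum>i\<in>UNIV. LINT x|lebesgue. frechet_derivative (\<lambda>x. F x $ i) (at x) (axis i 1))"
    unfolding divergence_def D by (intro Bochner_Integration.integral_sum) auto
  also have "\<dots> = 0"
    by (intro sum.neutral ballI integral_directional_derivative_zero[OF comp, of r]) (simp add: z)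
  finally show ?thesis .
qed

section \<open>Fields pointing into a half-space\<close>

lemma tendsto_inverse_Suc_sq: "(\<lambda>k. (1 / real (Suc k))\<^sup>2) \<longlonglongrightarrow> 0"
proof -
  have "(\<lambda>k. 1 / real (Suc k)) \<longlonglongrightarrow> 0" by (rule LIMSEQ_Suc[OF lim_1_over_n])
  from tendsto_power[OF this, of 2] show ?thesis by simp
qed

text \<open>
  A divergence theorem on a half-space, without integrals over the hyperplane: the indicator of
  the half-space is replaced by \<open>\<tau> = m / (m + t)\<close>, where \<open>m\<close> is the square of the
  positive part of \<open>v \<bullet> x\<close>. The full-space integral of \<open>div (\<tau> F)\<close> is zero, so the integral of
  \<open>\<tau> div F\<close> is minus that of \<open>\<nabla>\<tau> \<bullet> F\<close>. Near the hyperplane \<open>v \<bullet> F\<close> is at least \<open>- L (v \<bullet> x)\<close> by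
  Lipschitz continuity, and \<open>(v \<bullet> x)\<close> times the slope of \<open>\<tau>\<close> is \<open>2 m t / (m + t)\<^sup>2\<close>: it is bounded by
  1 and tends to 0 pointwise with \<open>t\<close>, so dominated convergence applies.
\<close>

lemma integral_divergence_half_space_nonpos:
  fixes F :: "real ^ 'm::finite \<Rightarrow> real ^ 'm"
  assumes F: "C_k 1 F" and z: "\<And>x. norm x > r \<Longrightarrow> F x = 0" and v: "norm v = 1"
    and inward: "\<And>x. v \<bullet> x = 0 \<Longrightarrow> 0 \<le> v \<bullet> F x"
  shows "(LINT x|lebesgue. indicator {x. v \<bullet> x > 0} x * divergence F x) \<le> 0"
proof -
  define m where "m x = possq (v \<bullet> x)" for x
  define t where "t k = (1 / real (Suc k))\<^sup>2" for k
  have t: "0 < t k" for k by (simp add: t_def)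
  have t0: "t \<longlonglongrightarrow> 0" unfolding t_def by (rule tendsto_inverse_Suc_sq)
  have m0: "0 \<le> m x" for x by (simp add: m_def possq_nonneg)
  have mt: "0 < m x + t k" for x k using m0[of x] t[of k] by linarith
  define \<tau> where "\<tau> k x = m x / (m x + t k)" for k x
  define e where "e k x = 2 * m x * t k / (m x + t k)\<^sup>2" for k x
  have s_C1: "C_k 1 (\<lambda>x. v \<bullet> x)"
    by (intro C1_bounded_linear bounded_linear_inner_right)
  have m_C1: "C_k 1 m" unfolding m_def by (intro C1_possq s_C1)
  have \<tau>_C1: "C_k 1 (\<tau> k)" for k
    unfolding \<tau>_def using mt by (intro C1_divide C1_add m_C1 C1_const)
  have F_zero: "divergence F x = 0" if "norm x > r" for x
    using divergence_zero_outside[OF z that] .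
  have "continuous_on UNIV (\<lambda>x. v \<bullet> frechet_derivative F (at x) v)"
    by (intro continuous_intros C1_continuous_derivative F)
  moreover have "v \<bullet> frechet_derivative F (at x) v = 0" if "norm x > r" for x
    by (simp add: frechet_derivative_eqI[OF derivative_zero_outside[OF z that]])
  ultimately obtain L where L: "L \<ge> 0" "\<And>x. \<bar>v \<bullet> frechet_derivative F (at x) v\<bar> \<le> L"
    using bounded_continuous_compact_support[of "\<lambda>x. v \<bullet> frechet_derivative F (at x) v" r] by blast
  \<comment> \<open>The value at \<open>x\<close> is compared with that at the orthogonal projection \<open>y\<close> of \<open>x\<close> to the hyperplane.\<close>
  have lip: "- (L * (v \<bullet> x)) \<le> v \<bullet> F x" if pos: "v \<bullet> x > 0" for x
  proof -
    define y where "y = x - (v \<bullet> x) *\<^sub>R v"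
    have vv: "v \<bullet> v = 1" using v by (simp add: dot_square_norm)
    have line: "((\<lambda>s. v \<bullet> F (y + s *\<^sub>R v)) has_real_derivative
        v \<bullet> frechet_derivative F (at (y + s *\<^sub>R v)) v) (at s)" for s
    proof -
      have "((\<lambda>s. y + s *\<^sub>R v) has_derivative (\<lambda>h. h *\<^sub>R v)) (at s)"
        by (auto intro!: derivative_eq_intros)
      from has_derivative_inner_right[OF has_derivative_compose[OF this C1_has_derivative[OF F]], of v]
      have "((\<lambda>s. v \<bullet> F (y + s *\<^sub>R v)) has_derivative
        (\<lambda>h. v \<bullet> frechet_derivative F (at (y + s *\<^sub>R v)) (h *\<^sub>R v))) (at s)" .
      moreover have "v \<bullet> frechet_derivative F (at (y + s *\<^sub>R v)) (h *\<^sub>R v)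
          = (v \<bullet> frechet_derivative F (at (y + s *\<^sub>R v)) v) * h" for h
        using linear_scale[OF has_derivative_linear[OF C1_has_derivative[OF F]]] by simp
      ultimately show ?thesis by (simp only: has_field_derivative_def)
    qed
    obtain \<xi> where "v \<bullet> F (y + (v \<bullet> x) *\<^sub>R v) - v \<bullet> F (y + 0 *\<^sub>R v)
        = (v \<bullet> x - 0) * (v \<bullet> frechet_derivative F (at (y + \<xi> *\<^sub>R v)) v)"
      using MVT2[OF pos, of "\<lambda>s. v \<bullet> F (y + s *\<^sub>R v)", OF line] by blast
    moreover have "0 \<le> v \<bullet> F y"
      by (rule inward) (simp add: y_def inner_diff_right vv)
    moreover have "(v \<bullet> x) * (v \<bullet> frechet_derivative F (at (y + \<xi> *\<^sub>R v)) v) \<ge> (v \<bullet> x) * (- L)"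
      using L(2)[of "y + \<xi> *\<^sub>R v"] pos by (intro mult_left_mono) linarith+
    ultimately show ?thesis by (simp add: y_def mult.commute)
  qed
  have \<tau>_deriv: "(\<tau> k has_derivative (\<lambda>u. (2 * max 0 (v \<bullet> x) * t k / (m x + t k)\<^sup>2) * (v \<bullet> u))) (at x)" for k x
  proof -
    have 1: "((\<lambda>x. v \<bullet> x) has_derivative (\<lambda>u. v \<bullet> u)) (at x)"
      by (intro bounded_linear_imp_has_derivative bounded_linear_inner_right)
    have "((\<lambda>y. possq y / (possq y + t k)) has_real_derivative
        (2 * max 0 y * t k / (possq y + t k)\<^sup>2)) (at y)" for y
      by (rule derivative_eq_intros DERIV_possq)+
         (use possq_nonneg[of y] t[of k] in \<open>auto simp: field_simps power2_eq_square\<close>)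
    from has_derivative_real_compose[OF 1 this] show ?thesis
      unfolding \<tau>_def m_def .
  qed
  have pointwise: "\<tau> k x * divergence F x
      \<le> divergence (\<lambda>x. \<tau> k x *\<^sub>R F x) x + L * (indicat_real (cball 0 r) x * e k x)" for k x
  proof -
    let ?w = "2 * max 0 (v \<bullet> x) * t k / (m x + t k)\<^sup>2"
    have "?w * (v \<bullet> F x) \<ge> - (L * (indicat_real (cball 0 r) x * e k x))"
    proof (cases "norm x > r \<or> v \<bullet> x \<le> 0")
      case True
      then show ?thesis using z[of x] by (auto simp: e_def m_def possq_def max_def)
    next
      case False
      then have "?w * (v \<bullet> F x) \<ge> ?w * (- (L * (v \<bullet> x)))"
        using lip[of x] t[of k] by (intro mult_left_mono) auto
      also have "?w * (- (L * (v \<bullet> x))) = - (L * (indicat_real (cball 0 r) x * e k x))"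
        using False by (simp add: e_def m_def possq_def power2_eq_square max_def)
      finally show ?thesis .
    qed
    then show ?thesis by (simp add: divergence_scaleR[OF \<tau>_deriv F])
  qed
  have TF: "C_k 1 (\<lambda>x. \<tau> k x *\<^sub>R F x)" "norm x > r \<Longrightarrow> \<tau> k x *\<^sub>R F x = 0" for k x
    using \<tau>_C1 F z by (auto intro: C1_scaleR simp del: One_nat_def)
  have e_cont: "continuous_on UNIV (e k)" for k
    unfolding e_def using mt by (intro continuous_intros C1_continuous[OF m_C1]) (metis less_irrefl power_eq_0_iff)
  have e_meas: "e k \<in> borel_measurable lebesgue" for k
    using e_cont by (rule borel_measurable_lebesgue_continuous)
  have e_bound: "0 \<le> e k x" "e k x \<le> 1" for k x
  proof -
    show "0 \<le> e k x" using m0[of x] t[of k] by (simp add: e_def)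
    have "2 * m x * t k \<le> (m x + t k)\<^sup>2" by (simp add: power2_sum)
    then show "e k x \<le> 1" using mt[of x k] by (simp add: e_def divide_le_eq)
  qed
  have Le_int: "integrable lebesgue (\<lambda>x. indicat_real (cball 0 r) x * e k x)" for k
    by (rule Bochner_Integration.integrable_bound[OF integrable_indicator_cball[of 0 r]])
       (use e_bound borel_measurable_times[OF borel_measurable_integrable[OF integrable_indicator_cball] e_meas]
         in \<open>auto simp: abs_mult mult_left_le\<close>)
  have T_int: "integrable lebesgue (divergence (\<lambda>x. \<tau> k x *\<^sub>R F x))" for k
    using integrable_continuous_compact_support[OF continuous_divergence[OF TF(1)] _ divergence_zero_outside[OF TF(2)], of UNIV]
    by simp
  have \<tau>_cont: "continuous_on UNIV (\<lambda>x. \<tau> k x * divergence F x)" for k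
    by (intro continuous_intros C1_continuous[OF \<tau>_C1] continuous_divergence[OF F])
  have \<tau>_int: "integrable lebesgue (\<lambda>x. \<tau> k x * divergence F x)" for k
    using integrable_continuous_compact_support[OF \<tau>_cont, of UNIV r] F_zero by simp
  have "(LINT x|lebesgue. \<tau> k x * divergence F x)
      \<le> L * (LINT x|lebesgue. indicat_real (cball 0 r) x * e k x)" for k
  proof -
    have "(LINT x|lebesgue. \<tau> k x * divergence F x)
      \<le> (LINT x|lebesgue. divergence (\<lambda>x. \<tau> k x *\<^sub>R F x) x + L * (indicat_real (cball 0 r) x * e k x))"
      by (intro integral_mono \<tau>_int T_int Le_int Bochner_Integration.integrable_add integrable_mult_right pointwise)
    also have "\<dots> = (LINT x|lebesgue. divergence (\<lambda>x. \<tau> k x *\<^sub>R F x) x)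
        + L * (LINT x|lebesgue. indicat_real (cball 0 r) x * e k x)"
      using T_int Le_int by simp
    also have "(LINT x|lebesgue. divergence (\<lambda>x. \<tau> k x *\<^sub>R F x) x) = 0"
      by (rule integral_divergence_zero[OF TF])
    finally show ?thesis by simp
  qed
  moreover have "(\<lambda>k. L * (LINT x|lebesgue. indicat_real (cball 0 r) x * e k x)) \<longlonglongrightarrow> L * 0"
  proof (intro tendsto_mult tendsto_const)
    have "(\<lambda>k. LINT x|lebesgue. indicat_real (cball 0 r) x * e k x) \<longlonglongrightarrow> (LINT x::real^'m|lebesgue. 0)"
    proof (rule integral_dominated_convergence[where w="indicat_real (cball 0 r)"])
      show "AE x in lebesgue. (\<lambda>k. indicat_real (cball 0 r) x * e k x) \<longlonglongrightarrow> 0"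
      proof (rule AE_I2)
        fix x :: "real ^ 'm"
        have "(\<lambda>k. e k x) \<longlonglongrightarrow> 0"
        proof (cases "m x = 0")
          case False
          have "(\<lambda>k. e k x) \<longlonglongrightarrow> 2 * m x * 0 / (m x + 0)\<^sup>2"
            unfolding e_def using False by (intro tendsto_intros t0) simp
          then show ?thesis by simp
        qed (simp add: e_def)
        then show "(\<lambda>k. indicat_real (cball 0 r) x * e k x) \<longlonglongrightarrow> 0"
          using tendsto_mult_right_zero by blast
      qed
    qed (use e_bound Le_int integrable_indicator_cball[of 0 r] in
           \<open>auto simp: indicator_def[abs_def] abs_mult intro: borel_measurable_integrable\<close>)
    then show "(\<lambda>k. LINT x|lebesgue. indicat_real (cball 0 r) x * e k x) \<longlonglongrightarrow> 0" by simp
  qed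
  moreover have "(\<lambda>k. LINT x|lebesgue. \<tau> k x * divergence F x)
      \<longlonglongrightarrow> (LINT x|lebesgue. indicator {x. v \<bullet> x > 0} x * divergence F x)"
  proof (rule integral_dominated_convergence[where w="\<lambda>x. \<bar>divergence F x\<bar>"])
    have dF: "integrable lebesgue (divergence F)"
      using integrable_continuous_compact_support[OF continuous_divergence[OF F] _ F_zero, of UNIV] by simp
    then show "integrable lebesgue (\<lambda>x. \<bar>divergence F x\<bar>)" by simp
    have "open {x. v \<bullet> x > 0}" by (rule open_halfspace_gt)
    then have "{x. v \<bullet> x > 0} \<in> sets lebesgue" by auto
    then show "(\<lambda>x. indicat_real {x. v \<bullet> x > 0} x * divergence F x) \<in> borel_measurable lebesgue"
      using dF by (intro borel_measurable_times borel_measurable_indicator borel_measurable_integrable)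
    show "(\<lambda>x. \<tau> k x * divergence F x) \<in> borel_measurable lebesgue" for k
      using \<tau>_int by (rule borel_measurable_integrable)
    show "AE x in lebesgue. norm (\<tau> k x * divergence F x) \<le> \<bar>divergence F x\<bar>" for k
    proof (rule AE_I2)
      fix x
      have "\<bar>\<tau> k x\<bar> \<le> 1" using m0[of x] t[of k] by (simp add: \<tau>_def)
      then show "norm (\<tau> k x * divergence F x) \<le> \<bar>divergence F x\<bar>"
        by (simp add: abs_mult mult_left_le_one_le)
    qed
    show "AE x in lebesgue. (\<lambda>k. \<tau> k x * divergence F x)
        \<longlonglongrightarrow> indicat_real {x. v \<bullet> x > 0} x * divergence F x"
    proof (rule AE_I2)
      fix x
      have "(\<lambda>k. \<tau> k x) \<longlonglongrightarrow> indicat_real {x. v \<bullet> x > 0} x"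
      proof (cases "v \<bullet> x > 0")
        case True
        then have "m x \<noteq> 0" by (simp add: m_def possq_eq_0_iff)
        then have "(\<lambda>k. \<tau> k x) \<longlonglongrightarrow> m x / (m x + 0)"
          unfolding \<tau>_def by (intro tendsto_intros t0) simp
        then show ?thesis using True \<open>m x \<noteq> 0\<close> by simp
      next
        case False
        then have "m x = 0" by (simp add: m_def possq_eq_0_iff)
        then show ?thesis using False by (simp add: \<tau>_def)
      qed
      then show "(\<lambda>k. \<tau> k x * divergence F x) \<longlonglongrightarrow> indicat_real {x. v \<bullet> x > 0} x * divergence F x"
        by (intro tendsto_mult tendsto_const)
    qed
  qed
  ultimately show ?thesis
    using LIMSEQ_le by fastforce
qed

section \<open>Perimeter of a conformal metric as a weighted Euclidean perimeter\<close>

lemma vol_density_conformal: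
  "vol_density (conformal_metric \<phi>) (x :: real ^ 'm::finite)
     = exp (real CARD('m) / 2 * \<phi> (norm x))"
proof -
  let ?A = "\<chi> i j. conformal_metric \<phi> x (axis i 1) (axis j 1) :: real ^ 'm ^ 'm"
  have "det ?A = (\<Prod>i\<in>UNIV. ?A $ i $ i)"
    by (rule det_diagonal) (simp add: conformal_metric_def inner_axis_axis)
  also have "\<dots> = exp (\<phi> (norm x)) ^ CARD('m)"
    by (simp add: conformal_metric_def inner_axis_axis)
  also have "\<dots> = (exp (real CARD('m) / 2 * \<phi> (norm x)))\<^sup>2"
    by (simp flip: exp_of_nat_mult)
  finally show ?thesis
    by (simp add: vol_density_def)
qed

text \<open>
  The fields that test the weighted perimeter, in which boundary measure carries the density \<open>h\<close>.
\<close>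

definition weighted_fields ::
  "(real ^ 'm \<Rightarrow> real) \<Rightarrow> (real ^ 'm) set \<Rightarrow> (real ^ 'm \<Rightarrow> real ^ 'm::finite) set" where
  "weighted_fields h W = {F. C_k 1 F \<and> (\<exists>K. compact K \<and> K \<subseteq> W \<and> (\<forall>x. x \<notin> K \<longrightarrow> F x = 0)) \<and>
     (\<forall>x. norm (F x) \<le> h x)}"

text \<open>
  In dimension \<open>N\<close> the volume density of \<open>e\<^sup>\<phi>\<close> times the Euclidean metric is \<open>w = exp (N \<phi> / 2)\<close>.
  The substitution \<open>F = w X\<close> turns the Riemannian divergence, integrated against the Riemannian
  volume, into the Euclidean divergence of \<open>F\<close> integrated against Lebesgue measure. The
  constraint that \<open>X\<close> has Riemannian length at most 1 becomes \<open>|F| \<le> exp ((N - 1) \<phi> / 2)\<close>: one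
  factor \<open>exp (\<phi> / 2)\<close> is used up by the length of \<open>X\<close>.
\<close>

lemma perimeter_conformal:
  fixes E W :: "(real ^ 'm::finite) set"
  assumes P: "C_k 1 (\<lambda>x :: real ^ 'm. \<phi> (norm x))" and E: "E \<in> sets lebesgue"
  shows "perimeter (conformal_metric \<phi>) E W =
    (SUP F \<in> weighted_fields (\<lambda>x. exp ((real CARD('m) - 1) / 2 * \<phi> (norm x))) W.
       ereal (LINT x|lebesgue. indicator E x * divergence F x))"
proof -
  let ?g = "conformal_metric \<phi> :: 'm metric"
  define w where "w x = exp (real CARD('m) / 2 * \<phi> (norm x))" for x :: "real ^ 'm"
  define w' where "w' x = exp (- (real CARD('m) / 2) * \<phi> (norm x))" for x :: "real ^ 'm"
  define h where "h x = exp ((real CARD('m) - 1) / 2 * \<phi> (norm x))" for x :: "real ^ 'm"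
  have ww': "w x * w' x = 1" "w' x * w x = 1" for x
    by (simp_all add: w_def w'_def flip: exp_add)
  have w_pos: "w x > 0" "w' x > 0" for x by (simp_all add: w_def w'_def)
  have w_C1: "C_k 1 w" "C_k 1 w'"
    unfolding w_def w'_def by (intro C1_exp C1_mult C1_const P)+
  have vd: "vol_density ?g = w"
    by (rule ext) (simp add: vol_density_conformal w_def)
  have len: "sqrt (?g x u u) \<le> 1 \<longleftrightarrow> norm (w x *\<^sub>R u) \<le> h x" for x u
  proof -
    have "sqrt (?g x u u) = exp (\<phi> (norm x) / 2) * norm u"
    proof -
      have "?g x u u = (exp (\<phi> (norm x) / 2) * norm u)\<^sup>2"
        by (simp add: conformal_metric_def power_mult_distrib power2_norm_eq_inner flip: exp_double)
      then show ?thesis by simp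
    qed
    moreover have "w x = exp (\<phi> (norm x) / 2) * h x"
      by (simp add: w_def h_def field_simps flip: exp_add)
    ultimately show ?thesis
      by (simp add: h_def mult.commute mult.left_commute)
  qed
  have fields: "(\<lambda>x. w x *\<^sub>R X x) \<in> weighted_fields h W \<longleftrightarrow> X \<in> test_fields ?g W" for X
  proof -
    have "C_k 1 (\<lambda>x. w x *\<^sub>R X x) \<longleftrightarrow> C_k 1 X"
    proof
      assume "C_k 1 (\<lambda>x. w x *\<^sub>R X x)"
      from C1_scaleR[OF w_C1(2) this] show "C_k 1 X" by (simp add: ww')
    qed (intro C1_scaleR w_C1)
    moreover have "w x *\<^sub>R u = 0 \<longleftrightarrow> u = 0" for x and u :: "real ^ 'm"
      using w_pos(1)[of x] by simp
    ultimately show ?thesis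
      by (simp only: weighted_fields_def test_fields_def len mem_Collect_eq)
  qed
  have integrals: "(LINT x:E|riem_vol ?g. riem_div ?g X x)
      = (LINT x|lebesgue. indicator E x * divergence (\<lambda>x. w x *\<^sub>R X x) x)"
    if "X \<in> test_fields ?g W" for X
  proof -
    have C1: "C_k 1 (\<lambda>x. w x *\<^sub>R X x)"
      using that fields[of X] by (simp add: weighted_fields_def del: One_nat_def)
    have div: "riem_div ?g X x = divergence (\<lambda>x. w x *\<^sub>R X x) x / w x" for x
      by (simp add: riem_div_def vd divergence_def)
    have "continuous_on UNIV (riem_div ?g X)"
      unfolding div using w_pos
      by (intro continuous_intros continuous_divergence C1 C1_continuous[OF w_C1(1)]) (simp add: less_imp_neq[symmetric])
    then have m: "riem_div ?g X \<in> borel_measurable lebesgue"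
      by (rule borel_measurable_lebesgue_continuous)
    have wm: "w \<in> borel_measurable lebesgue"
      by (rule borel_measurable_lebesgue_continuous[OF C1_continuous[OF w_C1(1)]])
    have "(LINT x:E|riem_vol ?g. riem_div ?g X x)
       = (LINT x|lebesgue. w x *\<^sub>R (indicat_real E x *\<^sub>R riem_div ?g X x))"
      unfolding riem_vol_def vd set_lebesgue_integral_def
      by (rule integral_density) (use E m wm w_pos in \<open>auto intro!: less_imp_le\<close>)
    also have "\<dots> = (LINT x|lebesgue. indicator E x * divergence (\<lambda>x. w x *\<^sub>R X x) x)"
      using w_pos(1)[THEN less_imp_neq] by (intro Bochner_Integration.integral_cong refl) (simp add: div)
    finally show ?thesis .
  qed
  show ?thesis
    unfolding perimeter_def h_def[symmetric]
  proof (rule SUP_eq)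
    fix X assume "X \<in> test_fields ?g W"
    then show "\<exists>F\<in>weighted_fields h W. ereal (LINT x:E|riem_vol ?g. riem_div ?g X x)
        \<le> ereal (LINT x|lebesgue. indicator E x * divergence F x)"
      using fields integrals by (intro bexI[of _ "\<lambda>x. w x *\<^sub>R X x"]) auto
  next
    fix F assume F: "F \<in> weighted_fields h W"
    have eq: "(\<lambda>x. w x *\<^sub>R w' x *\<^sub>R F x) = F" by (simp add: ww')
    with F fields[of "\<lambda>x. w' x *\<^sub>R F x"] have "(\<lambda>x. w' x *\<^sub>R F x) \<in> test_fields ?g W" by simp
    then show "\<exists>X\<in>test_fields ?g W. ereal (LINT x|lebesgue. indicator E x * divergence F x)
        \<le> ereal (LINT x:E|riem_vol ?g. riem_div ?g X x)"
      using integrals[of "\<lambda>x. w' x *\<^sub>R F x"] eq by (intro bexI[of _ "\<lambda>x. w' x *\<^sub>R F x"]) auto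
  qed
qed

section \<open>The calibrating field\<close>

text \<open>
  Write \<open>s = v \<bullet> x\<close> and \<open>R = |x|\<^sup>2 + \<epsilon>\<close>. The calibrating field points along \<open>R v + (c - 1) s x\<close> and is
  divided by the square root of \<open>R (R + (c\<^sup>2 - 1) s\<^sup>2)\<close>, which for \<open>\<epsilon> = 0\<close> is the length of this vector.
  For \<open>\<epsilon> > 0\<close> the square root overestimates the length, which is what keeps the field below the
  weight \<open>exp H\<close>, and equality remains on the hyperplane.
\<close>

definition calib_dir :: "real \<Rightarrow> real \<Rightarrow> 'a::euclidean_space \<Rightarrow> 'a \<Rightarrow> 'a" where
  "calib_dir c \<epsilon> v x = (x \<bullet> x + \<epsilon>) *\<^sub>R v + ((c - 1) * (v \<bullet> x)) *\<^sub>R x"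

definition calib_sq :: "real \<Rightarrow> real \<Rightarrow> 'a::euclidean_space \<Rightarrow> 'a \<Rightarrow> real" where
  "calib_sq c \<epsilon> v x = (x \<bullet> x + \<epsilon>) * (x \<bullet> x + \<epsilon> + (c\<^sup>2 - 1) * (v \<bullet> x)\<^sup>2)"

text \<open>
  The factor \<open>exp H\<close> over the square root is written as a single exponential, so that its
  logarithmic derivative can be read off.
\<close>

definition calib :: "('a \<Rightarrow> real) \<Rightarrow> real \<Rightarrow> real \<Rightarrow> 'a::euclidean_space \<Rightarrow> 'a \<Rightarrow> 'a" where
  "calib H c \<epsilon> v x = exp (H x - ln (calib_sq c \<epsilon> v x) / 2) *\<^sub>R calib_dir c \<epsilon> v x"

lemma calib_sq_pos:
  assumes "c \<ge> 1" "\<epsilon> > 0"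
  shows "calib_sq c \<epsilon> v x > 0"
proof -
  have "0 \<le> (c\<^sup>2 - 1) * (v \<bullet> x)\<^sup>2" using assms by simp
  moreover have "0 < x \<bullet> x + \<epsilon>" using assms by (simp add: add_nonneg_pos)
  ultimately show ?thesis by (simp add: calib_sq_def)
qed

lemma C1_calib:
  assumes H: "C_k 1 H" and c: "c \<ge> 1" "\<epsilon> > 0"
  shows "C_k 1 (calib_dir c \<epsilon> v)" "C_k 1 (calib_sq c \<epsilon> v)" "C_k 1 (calib H c \<epsilon> v)"
proof -
  have id: "C_k 1 (\<lambda>x::'a. x)" by (intro C1_bounded_linear bounded_linear_ident)
  show dir: "C_k 1 (calib_dir c \<epsilon> v)"
    unfolding calib_dir_def[abs_def]
    by (intro C1_add C1_scaleR C1_mult C1_inner C1_const id)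
  show sq: "C_k 1 (calib_sq c \<epsilon> v)"
    unfolding calib_sq_def[abs_def] power2_eq_square
    by (intro C1_add C1_diff C1_mult C1_inner C1_const id)
  show "C_k 1 (calib H c \<epsilon> v)"
    unfolding calib_def[abs_def] using calib_sq_pos[OF c]
    by (intro C1_scaleR C1_exp C1_diff C1_divide C1_ln C1_const dir sq H) auto
qed

lemma norm_calib_dir_le:
  assumes c: "c \<ge> 1" "\<epsilon> > 0" and v: "norm v = 1"
  shows "(norm (calib_dir c \<epsilon> v x))\<^sup>2 \<le> calib_sq c \<epsilon> v x"
proof -
  have vv: "v \<bullet> v = 1" using v by (simp add: dot_square_norm)
  define s where "s = v \<bullet> x"
  define r where "r = x \<bullet> x"
  have "(norm (calib_dir c \<epsilon> v x))\<^sup>2 = (r + \<epsilon>)\<^sup>2 + 2 * (r + \<epsilon>) * (c - 1) * s\<^sup>2 + (c - 1)\<^sup>2 * s\<^sup>2 * r"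
    unfolding power2_norm_eq_inner calib_dir_def
    by (simp add: inner_add_left inner_add_right vv inner_commute[of x v] flip: s_def r_def)
       (simp add: power2_eq_square algebra_simps)
  also have "\<dots> \<le> (r + \<epsilon>)\<^sup>2 + 2 * (r + \<epsilon>) * (c - 1) * s\<^sup>2 + (c - 1)\<^sup>2 * s\<^sup>2 * (r + \<epsilon>)"
    using c by (intro add_left_mono mult_left_mono) auto
  also have "\<dots> = calib_sq c \<epsilon> v x"
    by (simp add: calib_sq_def power2_eq_square algebra_simps flip: s_def r_def)
  finally show ?thesis .
qed

lemma exp_minus_half_ln: "y > 0 \<Longrightarrow> exp (a - ln y / 2) = exp a / sqrt (y::real)"
  by (simp add: exp_diff ln_sqrt[symmetric])

lemma norm_calib_le:
  assumes c: "c \<ge> 1" "\<epsilon> > 0" and v: "norm v = 1"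
  shows "norm (calib H c \<epsilon> v x) \<le> exp (H x)"
proof -
  have "norm (calib_dir c \<epsilon> v x) \<le> sqrt (calib_sq c \<epsilon> v x)"
    using norm_calib_dir_le[OF assms] by (rule real_le_rsqrt)
  then show ?thesis
    using calib_sq_pos[OF c, of v x]
    by (simp add: calib_def exp_minus_half_ln divide_le_eq mult_left_mono)
qed

lemma calib_on_hyperplane:
  assumes "\<epsilon> > 0" "v \<bullet> x = 0"
  shows "calib H c \<epsilon> v x = exp (H x) *\<^sub>R v"
proof -
  have "0 < x \<bullet> x + \<epsilon>" using assms by (simp add: add_nonneg_pos)
  then show ?thesis
    using assms(2) by (simp add: calib_def exp_minus_half_ln calib_sq_def calib_dir_def)
qed

lemma divergence_calib_dir:
  "divergence (calib_dir c \<epsilon> v) x = (v \<bullet> x) * (2 + (c - 1) * (real CARD('m) + 1))"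
  for x :: "real ^ 'm::finite"
proof -
  have "(calib_dir c \<epsilon> v has_derivative
     (\<lambda>u. (2 * (x \<bullet> u)) *\<^sub>R v + (((c - 1) * (v \<bullet> x)) *\<^sub>R u + ((c - 1) * (v \<bullet> u)) *\<^sub>R x))) (at x)"
    unfolding calib_dir_def[abs_def]
    by (auto intro!: derivative_eq_intros simp: inner_commute fun_eq_iff)
  from divergence_eqI[OF this] have "divergence (calib_dir c \<epsilon> v) x =
    (\<Sum>i\<in>UNIV. 2 * (x $ i * v $ i) + ((c - 1) * (v \<bullet> x) + (c - 1) * (v $ i * x $ i)))"
    by (simp add: inner_axis algebra_simps)
  also have "\<dots> = 2 * (v \<bullet> x) + (real CARD('m) * ((c - 1) * (v \<bullet> x)) + (c - 1) * (v \<bullet> x))"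
    by (simp add: sum.distrib inner_vec_def mult.commute flip: sum_distrib_left)
  finally show ?thesis by (simp add: algebra_simps)
qed

text \<open>
  This is the coefficient of \<open>v \<bullet> x\<close> in the divergence of the calibrating field, with \<open>r = |x|\<^sup>2\<close>,
  \<open>R = r + \<epsilon>\<close>, \<open>s = v \<bullet> x\<close> and \<open>a x\<close> for the gradient of \<open>H\<close>. It is linear in \<open>a r\<close>, whose lower bound contributes at worst
  \<open>- c (n - 2 c)\<close>, while the remaining terms are at least \<open>(c - 1) n - (c\<^sup>2 - 1)\<close>. For \<open>c\<^sup>2 = n - 1\<close>
  this equals \<open>c (n - 2 c)\<close>. This choice of \<open>c\<close> minimizes \<open>c + (n - 1) / c\<close>, with
  minimum \<open>2 c = 2 sqrt (n - 1)\<close>, which is how the threshold for \<open>\<kappa>\<close> arises.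
\<close>

lemma calib_coefficient_nonneg:
  fixes a c n r s R S :: real
  assumes c: "c \<ge> 1" and n: "n = c\<^sup>2 + 1" "0 \<le> n - 2 * c"
    and r: "0 \<le> r" "r < R" and S: "S = R + (c\<^sup>2 - 1) * s\<^sup>2" and a: "a * r \<ge> - (n - 2 * c)"
  shows "0 \<le> a * r * ((R + (c - 1) * r) / R) + (2 + (c - 1) * (n + 2)
       - ((R + (c - 1) * r) / R + (R + (c - 1) * r + (c\<^sup>2 - 1) * (R + (c - 1) * s\<^sup>2)) / S))"
proof -
  define q where "q = (R + (c - 1) * r) / R"
  have cr: "(c - 1) * r \<le> (c - 1) * R" "0 \<le> (c - 1) * r" using c r by (auto intro: mult_left_mono)
  have R: "R > 0" using r by simp
  have "R + (c - 1) * r \<le> c * R" using cr(1) by (simp add: algebra_simps)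
  then have q: "0 \<le> q" "q \<le> c" using cr R by (auto simp: q_def divide_le_eq)
  have c2: "c\<^sup>2 - 1 \<ge> 0" using c by simp
  have S_pos: "S > 0" using R c2 unfolding S by (simp add: add_pos_nonneg)
  have "R + (c - 1) * r + (c\<^sup>2 - 1) * (R + (c - 1) * s\<^sup>2)
      = (c - 1 + c\<^sup>2) * S - ((c - 1) * R - (c - 1) * r) - c\<^sup>2 * ((c\<^sup>2 - 1) * s\<^sup>2)"
    unfolding S by (simp add: algebra_simps)
  also have "\<dots> \<le> (c - 1 + c\<^sup>2) * S"
    using cr(1) mult_nonneg_nonneg[OF zero_le_power2[of c] mult_nonneg_nonneg[OF c2 zero_le_power2[of s]]]
    by linarith
  finally have "(R + (c - 1) * r + (c\<^sup>2 - 1) * (R + (c - 1) * s\<^sup>2)) / S \<le> c - 1 + c\<^sup>2"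
    using S_pos by (simp add: divide_le_eq)
  moreover have "a * r * q \<ge> - ((n - 2 * c) * c)"
  proof -
    have "(n - 2 * c) * q \<le> (n - 2 * c) * c" using q n by (intro mult_left_mono) auto
    moreover have "- ((n - 2 * c) * q) \<le> a * r * q"
      using mult_right_mono[OF a q(1)] by (simp only: mult_minus_left)
    ultimately show ?thesis by linarith
  qed
  moreover have "2 + (c - 1) * (n + 2) - (c + (c - 1 + c\<^sup>2)) = (n - 2 * c) * c"
    unfolding n by (simp add: algebra_simps power2_eq_square)
  ultimately show ?thesis using q unfolding q_def[symmetric] by linarith
qed

text \<open>
  Up to an error coming from the regularization, the divergence has the sign of \<open>v \<bullet> x\<close>. The
  derivative of \<open>H\<close> along the field is split with weights \<open>r / R\<close> and \<open>\<epsilon> / R\<close>, where \<open>r = |x|\<^sup>2\<close>: the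
  first part is controlled by the lower bound on \<open>a r\<close> and joins the nonnegative coefficient \<open>g\<close>;
  the second part cannot be signed, but it is bounded and disappears as \<open>\<epsilon>\<close> tends to 0.
\<close>

lemma divergence_calib:
  fixes x v :: "real ^ 'm::finite" and H :: "real ^ 'm \<Rightarrow> real"
  assumes H: "C_k 1 H" and v: "norm v = 1" and c: "c \<ge> 1" "\<epsilon> > 0"
    and n: "n = real CARD('m) - 1" "n = c\<^sup>2 + 1" "0 \<le> n - 2 * c"
    and radial: "\<And>u. frechet_derivative H (at x) u = a * (x \<bullet> u)" "a * (x \<bullet> x) \<ge> - (n - 2 * c)"
  obtains g where "g \<ge> 0" "divergence (calib H c \<epsilon> v) x =
     (v \<bullet> x) * g + \<epsilon> / (x \<bullet> x + \<epsilon>) * frechet_derivative H (at x) (calib H c \<epsilon> v x)"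
proof -
  define s where "s = v \<bullet> x"
  define r where "r = x \<bullet> x"
  define R where "R = r + \<epsilon>"
  define S where "S = R + (c\<^sup>2 - 1) * s\<^sup>2"
  define B where "B = calib_dir c \<epsilon> v x"
  define \<mu> where "\<mu> = exp (H x - ln (calib_sq c \<epsilon> v x) / 2)"
  let ?D = "frechet_derivative H (at x)"
  have vv: "v \<bullet> v = 1" using v by (simp add: dot_square_norm)
  have r: "0 \<le> r" "r < R" using c by (simp_all add: r_def R_def)
  have Q: "calib_sq c \<epsilon> v x = R * S" by (simp add: calib_sq_def r_def R_def S_def s_def)
  have Qp: "R * S > 0" using calib_sq_pos[OF c, of v x] by (simp add: Q)
  then have S_pos: "S > 0" using r by (simp add: zero_less_mult_iff)
  have xB: "x \<bullet> B = s * (R + (c - 1) * r)" and vB: "v \<bullet> B = R + (c - 1) * s\<^sup>2"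
    by (simp_all add: B_def calib_dir_def inner_add_right vv s_def r_def R_def inner_commute[of x v]
        power2_eq_square algebra_simps)
  define DQ where "DQ u = (2 * (x \<bullet> u)) * S + R * (2 * (x \<bullet> u) + (c\<^sup>2 - 1) * (2 * s * (v \<bullet> u)))" for u
  have DQ: "(calib_sq c \<epsilon> v has_derivative DQ) (at x)"
    unfolding calib_sq_def[abs_def]
    by (auto intro!: derivative_eq_intros simp: inner_commute fun_eq_iff DQ_def S_def R_def s_def r_def algebra_simps)
  have "((\<lambda>x. exp (H x - ln (calib_sq c \<epsilon> v x) / 2)) has_derivative
      (\<lambda>u. \<mu> * (?D u - DQ u / (2 * (R * S))))) (at x)"
  proof -
    have "((\<lambda>x. ln (calib_sq c \<epsilon> v x) / 2) has_derivative (\<lambda>u. 1 / (2 * (R * S)) * DQ u)) (at x)"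
      using Qp by (intro has_derivative_real_compose[OF DQ, of "\<lambda>y. ln y / 2"])
        (auto simp: Q intro!: derivative_eq_intros)
    from has_derivative_real_compose[OF has_derivative_diff[OF C1_has_derivative[OF H] this], of exp \<mu>]
    show ?thesis by (simp add: \<mu>_def)
  qed
  from divergence_scaleR[OF this C1_calib(1)[OF H c]]
  have "divergence (calib H c \<epsilon> v) x = \<mu> * (?D B - DQ B / (2 * (R * S)))
      + \<mu> * (s * (2 + (c - 1) * (n + 2)))"
    by (simp add: calib_def[abs_def] divergence_calib_dir B_def n(1) \<mu>_def s_def)
  also have "DQ B / (2 * (R * S)) = s * ((R + (c - 1) * r) / R
      + (R + (c - 1) * r + (c\<^sup>2 - 1) * (R + (c - 1) * s\<^sup>2)) / S)"
    unfolding DQ_def xB vB using r S_pos by (simp add: field_simps power2_eq_square)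
  also have "?D B = a * (s * (R + (c - 1) * r))"
    by (simp only: radial(1) xB)
  finally have div: "divergence (calib H c \<epsilon> v) x = \<mu> * (a * (s * (R + (c - 1) * r))
      - s * ((R + (c - 1) * r) / R + (R + (c - 1) * r + (c\<^sup>2 - 1) * (R + (c - 1) * s\<^sup>2)) / S))
      + \<mu> * (s * (2 + (c - 1) * (n + 2)))" .
  define g where "g = a * r * ((R + (c - 1) * r) / R) + (2 + (c - 1) * (n + 2)
       - ((R + (c - 1) * r) / R + (R + (c - 1) * r + (c\<^sup>2 - 1) * (R + (c - 1) * s\<^sup>2)) / S))"
  have "0 \<le> g"
    unfolding g_def using radial(2) by (intro calib_coefficient_nonneg c n r S_def) (simp add: r_def)
  then have g: "0 \<le> \<mu> * g" by (simp add: \<mu>_def)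
  have DZ: "?D (calib H c \<epsilon> v x) = \<mu> * (a * (s * (R + (c - 1) * r)))"
    by (simp only: calib_def radial(1) inner_scaleR_right B_def[symmetric] xB \<mu>_def) simp
  have split: "a * (s * (R + (c - 1) * r)) = s * (a * r * ((R + (c - 1) * r) / R))
      + \<epsilon> / R * (a * (s * (R + (c - 1) * r)))"
  proof -
    have "y = r / R * y + \<epsilon> / R * y" for y
      using r by (simp add: R_def flip: add_divide_distrib distrib_right)
    moreover have "r / R * (a * (s * y)) = s * (a * r * (y / R))" for y by simp
    ultimately show ?thesis by metis
  qed
  have regroup: "\<mu> * (A - s * J') + \<mu> * (s * J) = s * (\<mu> * (X + (J - J'))) + e * (\<mu> * A)"
    if "A = s * X + e * A" for A J J' X e :: real
    using that by algebra
  have "divergence (calib H c \<epsilon> v) x = s * (\<mu> * g) + \<epsilon> / R * ?D (calib H c \<epsilon> v x)"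
    unfolding div DZ g_def by (rule regroup[OF split])
  then show thesis
    using that[OF g] by (simp only: s_def R_def r_def)
qed

lemma divergence_calib_bounds:
  fixes x v :: "real ^ 'm::finite" and H :: "real ^ 'm \<Rightarrow> real"
  assumes H: "C_k 1 H" and v: "norm v = 1" and c: "c \<ge> 1" "\<epsilon> > 0"
    and n: "n = real CARD('m) - 1" "n = c\<^sup>2 + 1" "0 \<le> n - 2 * c"
    and radial: "\<exists>a. (\<forall>u. frechet_derivative H (at x) u = a * (x \<bullet> u)) \<and> a * (x \<bullet> x) \<ge> - (n - 2 * c)"
  defines "\<delta> \<equiv> \<epsilon> / (x \<bullet> x + \<epsilon>) * (exp (H x) * (\<Sum>i\<in>UNIV. \<bar>frechet_derivative H (at x) (axis i 1)\<bar>))"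
  shows "v \<bullet> x \<ge> 0 \<Longrightarrow> - \<delta> \<le> divergence (calib H c \<epsilon> v) x"
    and "v \<bullet> x \<le> 0 \<Longrightarrow> divergence (calib H c \<epsilon> v) x \<le> \<delta>"
proof -
  let ?D = "frechet_derivative H (at x)" and ?Z = "calib H c \<epsilon> v x"
  obtain g where g: "g \<ge> 0" "divergence (calib H c \<epsilon> v) x =
     (v \<bullet> x) * g + \<epsilon> / (x \<bullet> x + \<epsilon>) * ?D ?Z"
    using radial divergence_calib[OF H v c n] by metis
  have "\<bar>?D ?Z\<bar> \<le> norm ?Z * (\<Sum>i\<in>UNIV. \<bar>?D (axis i 1)\<bar>)"
    by (intro abs_linear_le_sum_axis has_derivative_bounded_linear[OF C1_has_derivative[OF H]])
  also have "\<dots> \<le> exp (H x) * (\<Sum>i\<in>UNIV. \<bar>?D (axis i 1)\<bar>)"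
    by (intro mult_right_mono norm_calib_le c v sum_nonneg) auto
  finally have "\<bar>\<epsilon> / (x \<bullet> x + \<epsilon>) * ?D ?Z\<bar> \<le> \<delta>"
    using c unfolding \<delta>_def abs_mult by (intro mult_mono) auto
  moreover have "v \<bullet> x \<ge> 0 \<Longrightarrow> 0 \<le> (v \<bullet> x) * g" "v \<bullet> x \<le> 0 \<Longrightarrow> (v \<bullet> x) * g \<le> 0"
    using g(1) by (auto intro: mult_nonneg_nonneg mult_nonpos_nonneg)
  ultimately show "v \<bullet> x \<ge> 0 \<Longrightarrow> - \<delta> \<le> divergence (calib H c \<epsilon> v) x"
    and "v \<bullet> x \<le> 0 \<Longrightarrow> divergence (calib H c \<epsilon> v) x \<le> \<delta>"
    unfolding g(2) by linarith+
qed

section \<open>Comparison of perimeters\<close>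

text \<open>
  The gradient of a radial function is a multiple \<open>a x\<close> of the position vector; away from the
  origin \<open>a = \<phi>' (|x|) / |x|\<close>, so the bound on \<open>\<phi>'\<close> becomes a bound on \<open>a |x|\<^sup>2\<close>. At the origin the
  gradient vanishes because the function is even.
\<close>

lemma radial_derivative:
  fixes \<phi> :: "real \<Rightarrow> real" and x :: "'a::euclidean_space"
  assumes P: "C_k 1 (\<lambda>x :: 'a. \<phi> (norm x))"
    and b: "\<And>r. r > 0 \<Longrightarrow> deriv \<phi> r \<ge> - b / r" and "b \<ge> 0"
  obtains a where "\<And>u. frechet_derivative (\<lambda>x. \<phi> (norm x)) (at x) u = a * (x \<bullet> u)"
    "a * (x \<bullet> x) \<ge> - b"
proof (cases "x = 0")
  case True
  let ?D = "frechet_derivative (\<lambda>x. \<phi> (norm x)) (at (0::'a))"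
  have "((\<lambda>x::'a. - x) has_derivative uminus) (at 0)" by (auto intro!: derivative_eq_intros)
  from has_derivative_compose[OF this, of "\<lambda>x. \<phi> (norm x)" ?D] C1_has_derivative[OF P, of 0]
  have "((\<lambda>x. \<phi> (norm x)) has_derivative (\<lambda>u. ?D (- u))) (at (0::'a))" by simp
  then have "?D = (\<lambda>u. ?D (- u))" by (rule frechet_derivative_eqI)
  moreover have "?D (- u) = - ?D u" for u
    using linear_neg[OF has_derivative_linear[OF C1_has_derivative[OF P]]] .
  ultimately have "?D u = - ?D u" for u by metis
  then show thesis using that[of 0] True \<open>b \<ge> 0\<close> by simp
next
  case False
  define r where "r = norm x"
  have r: "r > 0" using False by (simp add: r_def)
  let ?D = "frechet_derivative (\<lambda>x. \<phi> (norm x)) (at x)"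
  have "((\<lambda>s. s *\<^sub>R (x /\<^sub>R r)) has_derivative (\<lambda>h. h *\<^sub>R (x /\<^sub>R r))) (at r)"
    by (auto intro!: derivative_eq_intros)
  from has_derivative_compose[OF this, of "\<lambda>x. \<phi> (norm x)" ?D] C1_has_derivative[OF P, of x]
  have "((\<lambda>s. \<phi> (norm (s *\<^sub>R (x /\<^sub>R r)))) has_derivative (\<lambda>h. ?D (h *\<^sub>R (x /\<^sub>R r)))) (at r)"
    using r by simp
  moreover have "?D (h *\<^sub>R (x /\<^sub>R r)) = ?D (x /\<^sub>R r) * h" for h
    by (simp add: linear_scale[OF has_derivative_linear[OF C1_has_derivative[OF P]]])
  ultimately have "((\<lambda>s. \<phi> (norm (s *\<^sub>R (x /\<^sub>R r)))) has_real_derivative ?D (x /\<^sub>R r)) (at r)"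
    by (simp add: has_field_derivative_def)
  then have \<phi>': "(\<phi> has_real_derivative ?D (x /\<^sub>R r)) (at r)"
    by (rule has_field_derivative_transform_within[where d=r]) (use r in \<open>auto simp: dist_real_def field_simps r_def[symmetric]\<close>)
  define d where "d = ?D (x /\<^sub>R r)"
  have d: "(\<phi> has_real_derivative d) (at (norm x))" using \<phi>' by (simp add: d_def r_def)
  have "d \<ge> - b / r" using b[OF r] DERIV_imp_deriv[OF \<phi>'] by (simp add: d_def)
  then have dr: "d * r \<ge> - b" using r by (simp add: field_simps)
  have "(norm has_derivative (\<lambda>u. u \<bullet> sgn x)) (at x)"
    by (rule has_derivative_norm[OF False])
  from has_derivative_real_compose[OF this d]
  have "?D = (\<lambda>u. d * (u \<bullet> sgn x))" by (rule frechet_derivative_eqI)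
  then show thesis
    using that[of "d / r"] dr r
    by (simp add: sgn_div_norm r_def inner_commute dot_square_norm power2_eq_square field_simps)
qed

text \<open>
  The calibration argument. Let \<open>Y\<close> compete for the perimeter of the half-space \<open>U\<close>, and let \<open>F\<close> be
  minus the calibrating field, cut off outside a ball that contains the support of \<open>Y\<close> and the
  difference of \<open>E\<close> and \<open>U\<close>. On the hyperplane \<open>F\<close> is the longest admissible field that points
  out of \<open>U\<close>, so it has at least as much flux out of \<open>U\<close> as \<open>Y\<close>. Passing from
  \<open>U\<close> to \<open>E\<close> can lower the integral of \<open>div F\<close> only by the regularization error, because \<open>div F\<close> is
  essentially nonpositive on the part removed and nonnegative on the part added.
\<close>

lemma half_space_perimeter_le:
  fixes H :: "real ^ 'm::finite \<Rightarrow> real" and E :: "(real ^ 'm) set"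
  assumes H: "C_k 1 H" and v: "norm v = 1" and c: "c \<ge> 1"
    and n: "n = real CARD('m) - 1" "n = c\<^sup>2 + 1" "0 \<le> n - 2 * c"
    and radial: "\<And>x. \<exists>a. (\<forall>u. frechet_derivative H (at x) u = a * (x \<bullet> u)) \<and> a * (x \<bullet> x) \<ge> - (n - 2 * c)"
    and E: "E \<in> sets lebesgue"
    and K: "compact K" "K \<subseteq> ball 0 R" "sym_diff E {x. v \<bullet> x > 0} \<subseteq> K" and R: "R > 0"
  shows "(SUP F \<in> weighted_fields (\<lambda>x. exp (H x)) (ball 0 R).
            ereal (LINT x|lebesgue. indicator {x. v \<bullet> x > 0} x * divergence F x))
      \<le> (SUP F \<in> weighted_fields (\<lambda>x. exp (H x)) (ball 0 R).
            ereal (LINT x|lebesgue. indicator E x * divergence F x))"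
    (is "_ \<le> ?PE")
proof (rule SUP_least)
  define U where "U = {x. v \<bullet> x > 0}"
  have U: "U \<in> sets lebesgue"
    using open_halfspace_gt[of 0 v] by (auto simp: U_def)
  fix Y assume "Y \<in> weighted_fields (\<lambda>x. exp (H x)) (ball 0 R)"
  then obtain K' where Y: "C_k 1 Y" "\<And>x. norm (Y x) \<le> exp (H x)"
    and K': "compact K'" "K' \<subseteq> ball 0 R" "\<And>x. x \<notin> K' \<Longrightarrow> Y x = 0"
    by (auto simp: weighted_fields_def)
  obtain \<rho> where \<rho>: "0 < \<rho>" "\<rho> < R" "K \<union> K' \<subseteq> ball 0 \<rho>"
    using compact_subset_smaller_ball[of "K \<union> K'" R] K K' R by (metis Un_least compact_Un)
  \<comment> \<open>The gap between \<open>\<rho>\<close> and \<open>\<sigma>\<close> leaves room for the cutoff; \<open>\<sigma> < R\<close> keeps its support inside the open ball.\<close>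
  define \<sigma> where "\<sigma> = (\<rho> + R) / 2"
  have \<sigma>: "\<rho> < \<sigma>" "\<sigma> < R" using \<rho> by (auto simp: \<sigma>_def)
  obtain \<eta> :: "real ^ 'm \<Rightarrow> real" where \<eta>: "C_k 1 \<eta>" "\<And>x. 0 \<le> \<eta> x" "\<And>x. \<eta> x \<le> 1"
    "\<And>x. norm x \<le> \<rho> \<Longrightarrow> \<eta> x = 1" "\<And>x. norm x > \<sigma> \<Longrightarrow> \<eta> x = 0"
    using C1_cutoff[OF \<rho>(1) \<sigma>(1)] by blast
  have Y0: "Y x = 0" if "norm x > \<sigma>" for x
    using \<rho>(3) \<sigma> that by (intro K'(3)) (force simp: subset_iff)
  define t where "t k = (1 / real (Suc k))\<^sup>2" for k
  have t: "0 < t k" for k by (simp add: t_def)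
  have t0: "t \<longlonglongrightarrow> 0" unfolding t_def by (rule tendsto_inverse_Suc_sq)
  define Z where "Z k = calib H c (t k) v" for k
  have Z_C1: "C_k 1 (Z k)" for k unfolding Z_def by (rule C1_calib(3)[OF H c t])
  define F where "F k x = - (\<eta> x *\<^sub>R Z k x)" for k x
  have F_C1: "C_k 1 (F k)" for k
    unfolding F_def by (intro C1_minus C1_scaleR \<eta> Z_C1)
  have F0: "F k x = 0" if "norm x > \<sigma>" for k x
    using \<eta>(5)[OF that] by (simp add: F_def)
  have F_le: "norm (F k x) \<le> exp (H x)" for k x
  proof -
    have "norm (F k x) \<le> norm (Z k x)" using \<eta>(2,3)[of x] by (simp add: F_def mult_left_le_one_le)
    also have "\<dots> \<le> exp (H x)" unfolding Z_def by (rule norm_calib_le[OF c t v])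
    finally show ?thesis .
  qed
  have F_field: "F k \<in> weighted_fields (\<lambda>x. exp (H x)) (ball 0 R)" for k
    unfolding weighted_fields_def using F_C1 F_le F0 \<sigma>
    by (auto intro!: exI[of _ "cball 0 \<sigma>"] simp del: One_nat_def)
  define M where "M x = exp (H x) * (\<Sum>i\<in>UNIV. \<bar>frechet_derivative H (at x) (axis i 1)\<bar>)" for x
  have M: "M x \<ge> 0" for x by (auto simp: M_def intro!: sum_nonneg)
  \<comment> \<open>By the bounds on the divergence of the calibrating field, this function dominates the
    wrong-signed part on the ball; it tends to 0 off the origin and is bounded independently of \<open>k\<close>.\<close>
  define err where "err k x = indicat_real (cball 0 \<rho>) x * (t k / (x \<bullet> x + t k) * M x)" for k x
  have xt: "0 < x \<bullet> x + t k" for k and x :: "real ^ 'm" using t[of k] by (simp add: add_nonneg_pos)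
  have M_cont: "continuous_on UNIV M"
    unfolding M_def by (intro continuous_intros C1_continuous[OF H] C1_continuous_derivative[OF H])
  have M_int: "integrable lebesgue (\<lambda>x. indicat_real (cball 0 \<rho>) x * M x)"
  proof -
    have "integrable lebesgue (\<lambda>x. indicat_real (cball 0 \<rho>) x * (\<eta> x * M x))"
      by (rule integrable_continuous_compact_support[where r=\<sigma>])
         (use \<eta>(5) in \<open>auto intro!: continuous_on_mult C1_continuous[OF \<eta>(1)] M_cont\<close>)
    also have "(\<lambda>x. indicat_real (cball 0 \<rho>) x * (\<eta> x * M x)) = (\<lambda>x. indicat_real (cball 0 \<rho>) x * M x)"
      using \<eta>(4) by (auto simp: indicator_def)
    finally show ?thesis .
  qed
  have err_meas: "err k \<in> borel_measurable lebesgue" for k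
  proof -
    have "continuous_on UNIV (\<lambda>x :: real ^ 'm. t k / (x \<bullet> x + t k))"
      by (intro continuous_intros ballI) (rule less_imp_neq[OF xt, THEN not_sym])
    then have "(\<lambda>x :: real ^ 'm. t k / (x \<bullet> x + t k)) \<in> borel_measurable lebesgue"
      by (rule borel_measurable_lebesgue_continuous)
    from borel_measurable_times[OF this borel_measurable_integrable[OF M_int]]
    show ?thesis by (simp add: err_def[abs_def] mult_ac)
  qed
  have err_bound: "0 \<le> err k x" "err k x \<le> indicat_real (cball 0 \<rho>) x * M x" for k x
  proof -
    have "t k / (x \<bullet> x + t k) \<le> 1" "0 \<le> t k / (x \<bullet> x + t k)" using t[of k] xt[of x k] by simp_all
    then show "0 \<le> err k x" "err k x \<le> indicat_real (cball 0 \<rho>) x * M x"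
      using mult_left_le_one_le[OF M[of x], of "t k / (x \<bullet> x + t k)"]
        mult_nonneg_nonneg[OF _ M[of x], of "t k / (x \<bullet> x + t k)"]
      by (simp_all only: err_def indicator_def of_bool_def split: if_split) auto
  qed
  have err_int: "integrable lebesgue (err k)" for k
    by (rule Bochner_Integration.integrable_bound[OF M_int err_meas]) (use err_bound M in auto)
  have err0: "(\<lambda>k. LINT x|lebesgue. err k x) \<longlonglongrightarrow> 0"
  proof -
    have "(\<lambda>k. LINT x|lebesgue. err k x) \<longlonglongrightarrow> (LINT x::real^'m|lebesgue. 0)"
    proof (rule integral_dominated_convergence[where w="\<lambda>x. indicat_real (cball 0 \<rho>) x * M x"])
      show "AE x in lebesgue. (\<lambda>k. err k x) \<longlonglongrightarrow> 0"
      proof (rule AE_I[where N="{0}"])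
        show "{x \<in> space lebesgue. \<not> (\<lambda>k. err k x) \<longlonglongrightarrow> 0} \<subseteq> {0}"
        proof clarsimp
          fix x assume n: "\<not> (\<lambda>k. err k x) \<longlonglongrightarrow> 0"
          show "x = 0"
          proof (rule ccontr)
            assume "x \<noteq> 0"
            then have "(\<lambda>k. err k x) \<longlonglongrightarrow> indicat_real (cball 0 \<rho>) x * (0 / (x \<bullet> x + 0) * M x)"
              unfolding err_def by (intro tendsto_intros t0) simp
            then show False using n by simp
          qed
        qed
      qed auto
    qed (use err_bound err_meas M_int in auto)
    then show ?thesis by simp
  qed
  have int: "integrable lebesgue (\<lambda>x. indicat_real A x * divergence G x)"
    if "A \<in> sets lebesgue" "C_k 1 G" "\<And>x. norm x > \<sigma> \<Longrightarrow> G x = 0" for A and G :: "real ^ 'm \<Rightarrow> real ^ 'm"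
    by (rule integrable_continuous_compact_support[OF continuous_divergence[OF that(2)] that(1)
          divergence_zero_outside[OF that(3)]])
  \<comment> \<open>On the hyperplane \<open>v \<bullet> F k\<close> is \<open>- exp H\<close> wherever \<open>Y\<close> is nonzero, which is the least value that
    an admissible field can have; so \<open>Y - F k\<close> does not point out of \<open>U\<close>.\<close>
  have step1: "(LINT x|lebesgue. indicator U x * divergence Y x)
      \<le> (LINT x|lebesgue. indicator U x * divergence (F k) x)" for k
  proof -
    have "(LINT x|lebesgue. indicator {x. v \<bullet> x > 0} x * divergence (\<lambda>x. Y x - F k x) x) \<le> 0"
    proof (rule integral_divergence_half_space_nonpos[OF C1_diff[OF Y(1) F_C1] _ v])
      show "Y x - F k x = 0" if "norm x > \<sigma>" for x using Y0[OF that] F0[OF that] by simp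
      fix x assume x: "v \<bullet> x = 0"
      have vF: "v \<bullet> F k x = - (\<eta> x * exp (H x))"
        using calib_on_hyperplane[OF t x] v by (simp add: F_def Z_def dot_square_norm)
      have "- (\<eta> x * exp (H x)) \<le> v \<bullet> Y x"
      proof (cases "x \<in> K'")
        case True
        then have "\<eta> x = 1" using \<rho>(3) by (intro \<eta>(4)) (auto simp: subset_iff intro: less_imp_le)
        moreover have "\<bar>v \<bullet> Y x\<bar> \<le> exp (H x)"
          using Cauchy_Schwarz_ineq2[of v "Y x"] Y(2)[of x] v by simp
        ultimately show ?thesis by simp
      next
        case False
        then show ?thesis using K'(3) \<eta>(2)[of x] by simp
      qed
      then show "0 \<le> v \<bullet> (Y x - F k x)" by (simp add: inner_diff_right vF)
    qed
    then show ?thesis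
      using int[OF U Y(1) Y0] int[OF U F_C1 F0]
      by (simp add: divergence_diff[OF Y(1) F_C1] right_diff_distrib flip: U_def)
  qed
  have divF: "divergence (F k) x = - divergence (Z k) x" if "norm x < \<rho>" for k x
  proof -
    have "divergence (F k) x = divergence (\<lambda>x. - Z k x) x"
      by (rule divergence_cong_open[of "ball 0 \<rho>"]) (use that F_C1 \<eta>(4) in \<open>auto simp: F_def\<close>)
    then show ?thesis by (simp add: divergence_minus[OF Z_C1])
  qed
  \<comment> \<open>Where \<open>E\<close> and \<open>U\<close> differ the cutoff is 1, so the bounds on the divergence of \<open>Z k\<close> apply to \<open>F k\<close>.\<close>
  have step2: "(LINT x|lebesgue. indicator U x * divergence (F k) x)
      \<le> (LINT x|lebesgue. indicator E x * divergence (F k) x) + (LINT x|lebesgue. err k x)" for k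
  proof -
    have "(LINT x|lebesgue. indicator U x * divergence (F k) x)
      \<le> (LINT x|lebesgue. indicator E x * divergence (F k) x + err k x)"
    proof (intro integral_mono int U E F_C1 F0 err_int Bochner_Integration.integrable_add)
      fix x
      note b = divergence_calib_bounds[OF H v c t n radial, of x k, folded Z_def M_def]
      show "indicat_real U x * divergence (F k) x \<le> indicat_real E x * divergence (F k) x + err k x"
      proof (cases "x \<in> U \<longleftrightarrow> x \<in> E")
        case True
        then show ?thesis using err_bound(1)[of k x] by (simp add: indicator_def)
      next
        case False
        then have "x \<in> K" using K(3) by (auto simp: U_def)
        then have x: "norm x < \<rho>" using \<rho>(3) by auto
        then have "err k x = t k / (x \<bullet> x + t k) * M x" by (simp add: err_def)
        then have "v \<bullet> x \<ge> 0 \<Longrightarrow> divergence (F k) x \<le> err k x"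
          "v \<bullet> x \<le> 0 \<Longrightarrow> - err k x \<le> divergence (F k) x"
          using b divF[OF x, of k] by linarith+
        then show ?thesis
          using False by (cases "x \<in> E") (auto simp: U_def)
      qed
    qed auto
    then show ?thesis using int[OF E F_C1 F0] err_int by simp
  qed
  have le: "ereal ((LINT x|lebesgue. indicator U x * divergence Y x) - (LINT x|lebesgue. err k x)) \<le> ?PE" for k
  proof -
    have "(LINT x|lebesgue. indicator U x * divergence Y x) - (LINT x|lebesgue. err k x)
       \<le> (LINT x|lebesgue. indicator E x * divergence (F k) x)"
      using step1[of k] step2[of k] by linarith
    then show ?thesis
      by (intro SUP_upper2[OF F_field[of k]]) simp
  qed
  have "(\<lambda>k. ereal ((LINT x|lebesgue. indicator U x * divergence Y x) - (LINT x|lebesgue. err k x)))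
      \<longlonglongrightarrow> ereal ((LINT x|lebesgue. indicator U x * divergence Y x) - 0)"
    by (intro tendsto_ereal tendsto_diff tendsto_const err0)
  from LIMSEQ_le_const2[OF this] le
  show "ereal (LINT x|lebesgue. indicator {x. v \<bullet> x > 0} x * divergence Y x) \<le> ?PE"
    by (auto simp: U_def)
qed

theorem theorem3p4:
  fixes n :: nat and \<kappa> :: real and \<phi> :: "real \<Rightarrow> real" and T :: "(real ^ 'm::finite) set"
  assumes "CARD('m) = n + 1"
    and "n \<ge> 3"
    and "2 / real n * sqrt (real n - 1) \<le> \<kappa>" and "\<kappa> < 1"
    and "smooth (\<lambda>x :: real ^ 'm. \<phi> (norm x))"
    and "\<forall>r>0. deriv \<phi> r \<ge> - 2 * (1 - \<kappa>) / r"
    and "subspace T" and "dim T = n"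
  shows "area_minimizing (conformal_metric \<phi>) T"
proof -
  define c where "c = sqrt (real n - 1)"
  define H where "H x = real n / 2 * \<phi> (norm x)" for x :: "real ^ 'm"
  have c: "c \<ge> 1" "real n = c\<^sup>2 + 1" using assms(2) by (simp_all add: c_def)
  have n_pos: "real n > 0" using assms(2) by simp
  then have c\<kappa>: "2 * c \<le> real n * \<kappa>" using assms(3) by (simp add: c_def field_simps)
  moreover have "real n * \<kappa> \<le> real n * 1" using n_pos assms(4) by (intro mult_left_mono) auto
  ultimately have nc: "0 \<le> real n - 2 * c" by simp
  have P: "C_k 1 (\<lambda>x :: real ^ 'm. \<phi> (norm x))" using assms(5) unfolding smooth_def by blast
  have H: "C_k 1 H" unfolding H_def by (intro C1_mult C1_const P)
  \<comment> \<open>The factor \<open>n / 2\<close> in \<open>H\<close> turns the bound \<open>2 (1 - \<kappa>)\<close> into \<open>n (1 - \<kappa>)\<close>, which is at most \<open>n - 2 c\<close>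
    by the lower bound on \<open>\<kappa>\<close>.\<close>
  have radial: "\<exists>a. (\<forall>u. frechet_derivative H (at x) u = a * (x \<bullet> u)) \<and> a * (x \<bullet> x) \<ge> - (real n - 2 * c)" for x
  proof -
    obtain a where a: "\<And>u. frechet_derivative (\<lambda>x. \<phi> (norm x)) (at x) u = a * (x \<bullet> u)"
      "a * (x \<bullet> x) \<ge> - (2 * (1 - \<kappa>))"
      using radial_derivative[OF P, of "2 * (1 - \<kappa>)" x] assms(4,6) by auto
    have "frechet_derivative H (at x) = (\<lambda>u. real n / 2 * frechet_derivative (\<lambda>x. \<phi> (norm x)) (at x) u)"
      unfolding H_def by (intro frechet_derivative_eqI has_derivative_mult_right C1_has_derivative P)
    moreover have "real n / 2 * (a * (x \<bullet> x)) \<ge> real n / 2 * (- (2 * (1 - \<kappa>)))"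
      using a(2) n_pos by (intro mult_left_mono) auto
    moreover have "real n / 2 * (- (2 * (1 - \<kappa>))) = - (real n - real n * \<kappa>)"
      by (simp add: algebra_simps)
    ultimately have "real n / 2 * (a * (x \<bullet> x)) \<ge> - (real n - 2 * c)"
      "frechet_derivative H (at x) u = real n / 2 * (a * (x \<bullet> u))" for u
      using a(1) c\<kappa> by (linarith, simp)
    then show ?thesis
      by (intro exI[of _ "real n / 2 * a"]) (simp only: mult.assoc simp_thms)
  qed
  have card: "real n = real CARD('m) - 1" using assms(1) by simp
  show ?thesis
    unfolding area_minimizing_def perimeter_minimizing_in_ball_def
  proof (intro allI impI, elim conjE exE)
    fix U E K :: "(real ^ 'm) set" and R :: real
    assume U: "half_space_bounded_by T U" and R: "R > 0"
      and E: "locally_finite_perimeter (conformal_metric \<phi>) E"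
      and K: "compact K" "K \<subseteq> interior (cball 0 R)" "sym_diff E U \<subseteq> K"
    obtain w where w: "w \<noteq> 0" "U = {x. w \<bullet> x > 0}"
      using U by (auto simp: half_space_bounded_by_def)
    define v where "v = sgn w"
    have v: "norm v = 1" using w by (simp add: v_def norm_sgn)
    have Uv: "U = {x. v \<bullet> x > 0}"
      using w by (auto simp: v_def sgn_div_norm zero_less_mult_iff)
    have E': "E \<in> sets lebesgue" using E by (simp add: locally_finite_perimeter_def)
    have U': "U \<in> sets lebesgue" using open_halfspace_gt[of 0 v] by (auto simp: Uv)
    have ball: "interior (cball 0 R) = (ball 0 R :: (real ^ 'm) set)" by simp
    have h: "(\<lambda>x. exp ((real CARD('m) - 1) / 2 * \<phi> (norm x))) = (\<lambda>x :: real ^ 'm. exp (H x))"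
      by (simp add: H_def card)
    show "perimeter (conformal_metric \<phi>) U (interior (cball 0 R))
        \<le> perimeter (conformal_metric \<phi>) E (interior (cball 0 R))"
      unfolding perimeter_conformal[OF P U'] perimeter_conformal[OF P E'] h ball
      unfolding Uv using K(2,3)[unfolded ball Uv]
      by (intro half_space_perimeter_le[OF H v c(1) card c(2) nc radial E' K(1) _ _ R])
  qed
qed

end
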